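(* Let $d \ge 1$ be a fixed integer, let $\Delta \ge 0$ be a fixed real number, and put $s := \lfloor \Delta \rfloor + 1$. If $s - 1 \le \Delta < \sqrt{(s-1)^2 + 1}$, then there exists $n_0 = n_0(d, \Delta)$ such that for all integers $n \ge n_0$, $$p_d(n, \Delta) = 2^{-n} S(n, s).$$
   Context: For a multi-set $V = \{v_1,\dots,v_n\}$ of $n$ vectors in $\mathbb{R}^d$, $X_V := \xi_1 v_1 + \dots + \xi_n v_n$, where $\xi_1,\dots,\xi_n$ are i.i.d. Bernoulli random variables, each taking the values $1$ and $-1$ with probability $1/2$ each. Define $$p_d(n, \Delta) := \sup_{V, B} \mathbf{P}(X_V \in B),$$ where the supremum is over all multi-sets $V = \{v_1,\dots,v_n\}$ of $n$ vectors in $\mathbb{R}^d$, each of Euclidean length at least $1$, and over all closed Euclidean balls $B \subset \mathbb{R}^d$ of radius $\Delta$. $S(n, m)$ denotes the sum of the largest $m$ binomial coefficients among $\binom{n}{i}$, $0 \le i \le n$. *)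

theory Defs
  imports "HOL-Probability.Probability"
begin

definition rademacher_pmf :: "real pmf" where
  "rademacher_pmf = pmf_of_set {-1, 1}"

text \<open>Joint law of i.i.d. signs \<open>\<xi> 0, \<dots>, \<xi> (n - 1)\<close>; outside \<open>{..<n}\<close> the sign function is
  set to the dummy value \<open>0\<close>.\<close>

definition signs_pmf :: "nat \<Rightarrow> (nat \<Rightarrow> real) pmf" where
  "signs_pmf n = Pi_pmf {..<n} 0 (\<lambda>_. rademacher_pmf)"

text \<open>A multi-set of \<open>n\<close> vectors is given by an enumeration \<open>v 0, \<dots>, v (n - 1)\<close>, repetitions
  allowed; the values of \<open>v\<close> outside \<open>{..<n}\<close> are never used.\<close>

definition signed_sum :: "nat \<Rightarrow> (nat \<Rightarrow> 'a::real_vector) \<Rightarrow> (nat \<Rightarrow> real) \<Rightarrow> 'a" where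
  "signed_sum n v \<xi> = (\<Sum>i<n. \<xi> i *\<^sub>R v i)"

text \<open>The dimension is \<open>d = CARD('d)\<close>. For \<open>\<Delta> \<ge> 0\<close> the set below is nonempty and bounded above
  by \<open>1\<close>, so \<open>Sup\<close> is its actual supremum.\<close>

definition small_ball_prob :: "'d::finite itself \<Rightarrow> nat \<Rightarrow> real \<Rightarrow> real" where
  "small_ball_prob _ n \<Delta> =
     Sup {measure_pmf.prob (signs_pmf n) {\<xi>. signed_sum n v \<xi> \<in> cball c \<Delta>}
          | (v :: nat \<Rightarrow> real ^ 'd) (c :: real ^ 'd). \<forall>i<n. 1 \<le> norm (v i)}"

text \<open>If \<open>m > n + 1\<close>, this is the sum of all the binomial coefficients.\<close>

definition sum_largest_binomials :: "nat \<Rightarrow> nat \<Rightarrow> nat" where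
  "sum_largest_binomials n m =
     sum_list (take m (rev (sort (map (\<lambda>i. n choose i) [0..<Suc n]))))"

end

theory Submission
  imports Defs
begin

text \<open>
  Write \<open>T n s\<close> for the sum of the \<open>s\<close> middle binomial coefficients, which are also the largest. The
  value \<open>T n s / 2 ^ n\<close> is attained by \<open>n\<close> equal unit vectors: a ball of radius \<open>s - 1\<close> centred suitably contains \<open>s\<close>
  consecutive values of the sum (\<open>hits_replicate_lower\<close>).

  The upper bound is combinatorial. Adding the vectors one at a time as in the construction of
  symmetric chains decomposes the \<open>2 ^ n\<close> signed sums into blocks, and if no block meets a set in more
  than \<open>s\<close> points, the set is hit at most \<open>T n s\<close> times (\<open>block_decomposition\<close>). The number of blocks
  is \<open>T n 1\<close>, of order \<open>2 ^ n / sqrt n\<close>. For \<open>s = 1\<close> this gives the claim for all \<open>n\<close>, with Kleitman's blocks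
  of pairwise distant sums (\<open>kleitman_bound\<close>).

  Let \<open>s \<ge> 2\<close>. Cover the unit sphere by finitely many small caps and let \<open>u\<close> be the centre of the most
  popular one. If a positive proportion of the vectors is not close to the line of \<open>u\<close>, then there are
  two groups of proportional size along separated directions; a chain for the first and a chain for
  the second span a distorted grid with boundedly many points in the ball, so the probability is
  \<open>O(1 / n)\<close>, which is negligible (\<open>two_directions_bound\<close>). Otherwise almost all vectors, after changes
  of sign, lie in a narrow cone around \<open>u\<close>. If every vector has a projection to \<open>u\<close> longer than \<open>\<Delta> / s\<close>,
  the argument of Erdos bounds the number of hits by \<open>T n s\<close> (\<open>erdos_bound\<close>). If some \<open>w\<close> has a
  projection of length at most \<open>\<Delta> / s\<close>, a chain of sums of vectors from the cone meets the ball shifted by \<open>w\<close> and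
  by \<open>- w\<close> in at most \<open>2 * s - 1\<close> points altogether, by \<open>1 \<le> norm w\<close> and
  \<open>\<Delta>\<^sup>2 < (s - 1)\<^sup>2 + 1\<close> (\<open>shifted_pair_bound\<close>). Per chain this is an average of \<open>s - 1 / 2\<close> instead of
  \<open>s\<close>, and this gain outweighs the loss from ignoring the few vectors outside the cone
  (\<open>half_loss_beats_rounding\<close>).
\<close>

section \<open>Sums of middle binomial coefficients\<close>

text \<open>The sum of the \<open>s\<close> binomial coefficients nearest to the middle. The indices
  \<open>(n + j + 1) div 2\<close> all lie in the upper half, so that for \<open>j > n\<close> the coefficient is \<open>0\<close> and no
  side condition on \<open>s\<close> is needed; by symmetry the values are the coefficients in decreasing order.\<close>

definition middle_binomial_sum :: "nat \<Rightarrow> nat \<Rightarrow> nat" where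
  "middle_binomial_sum n s = (\<Sum>j<s. n choose ((n + j + 1) div 2))"

lemma choose_upper_half: "n choose ((n + 1) div 2) = n choose (n div 2)"
proof -
  have "n - (n + 1) div 2 = n div 2" by presburger
  then show ?thesis using binomial_symmetric[of "(n + 1) div 2" n] by (cases n) auto
qed

lemma middle_binomial_sum_0 [simp]: "middle_binomial_sum n 0 = 0"
  by (simp add: middle_binomial_sum_def)

lemma middle_binomial_sum_0_Suc [simp]: "middle_binomial_sum 0 (Suc s) = 1"
  by (induction s) (auto simp: middle_binomial_sum_def)

lemma middle_binomial_sum_1: "middle_binomial_sum n (Suc 0) = n choose (n div 2)"
  using choose_upper_half[of n] by (simp add: middle_binomial_sum_def)

lemma middle_binomial_sum_Suc:
  "middle_binomial_sum n (Suc s) = middle_binomial_sum n s + (n choose ((n + s + 1) div 2))"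
  by (simp add: middle_binomial_sum_def)

text \<open>The recursion that drives the whole counting: block sizes in \<open>block_decomposition\<close> and window
  counts in \<open>hits_replicate_one\<close> both satisfy it.\<close>

lemma middle_binomial_sum_Suc_Suc:
  "middle_binomial_sum (Suc n) (Suc s) = middle_binomial_sum n s + middle_binomial_sum n (Suc (Suc s))"
proof (induction s)
  case 0
  show ?case using choose_upper_half[of n]
    by (simp add: middle_binomial_sum_def)
next
  case (Suc s)
  have "Suc n choose ((Suc n + Suc s + 1) div 2)
      = (n choose ((n + s + 1) div 2)) + (n choose ((n + Suc (Suc s) + 1) div 2))"
    by simp
  with Suc show ?case
    by (simp only: middle_binomial_sum_Suc)
qed

lemma middle_binomial_decreasing:
  assumes "i \<le> j"
  shows "n choose ((n + j + 1) div 2) \<le> n choose ((n + i + 1) div 2)"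
proof (cases "(n + j + 1) div 2 \<le> n")
  case True
  then show ?thesis using assms
    by (intro binomial_antimono) (auto simp: div_le_mono)
next
  case False
  then show ?thesis by (simp add: binomial_eq_0)
qed

lemma sum_largest_binomials_eq:
  assumes "s \<le> Suc n"
  shows "sum_largest_binomials n s = middle_binomial_sum n s"
proof -
  define g where "g = (\<lambda>j. n choose ((n + j + 1) div 2))"
  \<comment> \<open>Going up through \<open>j\<close> visits the indices \<open>0, \<dots>, n\<close> outwards from the middle, alternating
    between the two sides.\<close>
  define h where "h = (\<lambda>j. if even (n + j) then (n + j) div 2 else (n - j) div 2)"
  have h_even: "2 * h j = n + j" if "even (n + j)" for j
    using that by (auto simp: h_def)
  have h_odd: "2 * h j + j + 1 = n" if "odd (n + j)" "j < Suc n" for j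
  proof -
    have "odd (n - j)" using that by simp
    then have "2 * ((n - j) div 2) + 1 = n - j" by (rule odd_two_times_div_two_succ)
    with that show ?thesis by (simp add: h_def)
  qed
  have inj: "inj_on h {..<Suc n}"
  proof (rule inj_onI)
    fix i j assume ij: "i \<in> {..<Suc n}" "j \<in> {..<Suc n}" "h i = h j"
    show "i = j"
      using ij h_even[of i] h_even[of j] h_odd[of i] h_odd[of j]
      by (cases "even (n + i)"; cases "even (n + j)") auto
  qed
  have "h ` {..<Suc n} \<subseteq> {..<Suc n}"
    unfolding h_def by auto
  then have bij: "h ` {..<Suc n} = {..<Suc n}"
    using inj by (simp add: endo_inj_surj)
  have gh: "n choose (h j) = g j" if "j < Suc n" for j
  proof (cases "even (n + j)")
    case True
    then show ?thesis by (simp add: h_def g_def)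
  next
    case False
    have "n - h j = (n + j + 1) div 2" using h_odd[OF False that] by simp
    moreover have "h j \<le> n" using h_odd[OF False that] by simp
    ultimately show ?thesis using binomial_symmetric[of "h j" n]
      by (simp add: g_def)
  qed
  have "mset (map (\<lambda>i. n choose i) [0..<Suc n]) = image_mset ((choose) n) (mset_set (h ` {..<Suc n}))"
    unfolding bij by (simp add: lessThan_atLeast0 del: upt_Suc)
  also have "\<dots> = image_mset ((choose) n) (image_mset h (mset_set {..<Suc n}))"
    using inj by (simp add: image_mset_mset_set)
  also have "\<dots> = image_mset g (mset_set {..<Suc n})"
    using gh by (auto simp: multiset.map_comp intro!: image_mset_cong)
  also have "\<dots> = mset (rev (map g [0..<Suc n]))"
    by (simp add: lessThan_atLeast0 del: upt_Suc)
  finally have m: "mset (rev (map g [0..<Suc n])) = mset (map (\<lambda>i. n choose i) [0..<Suc n])" ..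
  have "g y \<le> g x" if "x < y" for x y
    unfolding g_def using that by (intro middle_binomial_decreasing) simp
  then have "sorted_wrt (\<lambda>x y. y \<le> x) (map g [0..<Suc n])"
    unfolding sorted_wrt_map
    by (rule sorted_wrt_mono_rel[OF _ sorted_wrt_upt]) simp
  then have "sorted (rev (map g [0..<Suc n]))"
    by (simp only: sorted_wrt_rev)
  with m have "sort (map (\<lambda>i. n choose i) [0..<Suc n]) = rev (map g [0..<Suc n])"
    by (intro properties_for_sort) auto
  then have "sum_largest_binomials n s = sum_list (take s (map g [0..<Suc n]))"
    by (simp add: sum_largest_binomials_def del: upt_Suc)
  also have "\<dots> = sum_list (map g [0..<s])"
    using assms by (simp add: take_map del: upt_Suc)
  also have "\<dots> = middle_binomial_sum n s"
    by (simp add: middle_binomial_sum_def g_def interv_sum_list_conv_sum_set_nat lessThan_atLeast0)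
  finally show ?thesis .
qed

section \<open>The central binomial probability\<close>

text \<open>The largest point probability of a sum of \<open>n\<close> signs. It is of order \<open>1 / sqrt n\<close>; more
  precisely, up to rounding, \<open>n\<close> times its square increases with \<open>n\<close>, while \<open>n + 1\<close> times its square is at
  most \<open>1\<close>. These two facts make an asymptotic formula unnecessary.\<close>

definition central_prob :: "nat \<Rightarrow> real" where
  "central_prob n = real (n choose (n div 2)) / 2 ^ n"

lemma central_prob_pos: "central_prob n > 0"
  by (simp add: central_prob_def zero_less_binomial_iff)

lemma central_prob_odd: "central_prob (2 * k + 1) = central_prob (2 * k + 2)"
proof -
  have "(2 * k + 2) choose (k + 1) = 2 * ((2 * k + 1) choose k)"
    using choose_upper_half[of "2 * k + 1"] by simp
  then show ?thesis
    unfolding central_prob_def by simp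
qed

lemma central_prob_even_Suc:
  "central_prob (2 * Suc k) = central_prob (2 * k) * (2 * real k + 1) / (2 * real k + 2)"
proof -
  have "(2 * k + 1 - k) * ((2 * k + 1) choose k) = (2 * k + 1) * ((2 * k) choose k)"
    by (subst binomial_absorb_comp) auto
  then have "real (2 * k + 1 - k) * real ((2 * k + 1) choose k) = real (2 * k + 1) * real ((2 * k) choose k)"
    by (simp only: of_nat_mult[symmetric])
  then have "(real k + 1) * real ((2 * k + 1) choose k) = (2 * real k + 1) * real ((2 * k) choose k)"
    by (simp add: algebra_simps)
  then have "real ((2 * k + 1) choose k) = (2 * real k + 1) * real ((2 * k) choose k) / (real k + 1)"
    by (simp add: eq_divide_eq mult.commute)
  moreover have "real k * 2 + 2 = (real k + 1) * 2" by simp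
  ultimately have "central_prob (2 * k + 1) = central_prob (2 * k) * (2 * real k + 1) / (2 * real k + 2)"
    unfolding central_prob_def by (simp add: mult_ac)
  then show ?thesis using central_prob_odd by simp
qed

lemma central_prob_round: "\<exists>k. n \<le> 2 * k \<and> 2 * k \<le> n + 1 \<and> central_prob n = central_prob (2 * k)"
proof (cases "even n")
  case True
  then show ?thesis by (auto elim!: evenE)
next
  case False
  then obtain k where "n = 2 * k + 1" by (auto elim!: oddE)
  then show ?thesis using central_prob_odd[of k] by (intro exI[of _ "k + 1"]) auto
qed

lemma central_prob_even_le: "central_prob (2 * k) ^ 2 * (2 * real k + 1) \<le> 1"
proof (induction k)
  case 0
  then show ?case by (simp add: central_prob_def)
next
  case (Suc k)
  have "central_prob (2 * Suc k) ^ 2 * (2 * real (Suc k) + 1)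
      = central_prob (2 * k) ^ 2 * (2 * real k + 1) * ((2 * real k + 1) * (2 * real k + 3) / (2 * real k + 2) ^ 2)"
    unfolding central_prob_even_Suc by (simp add: power2_eq_square power_divide power_mult_distrib algebra_simps)
  also have "\<dots> \<le> 1 * 1"
  proof (intro mult_mono Suc)
    show "(2 * real k + 1) * (2 * real k + 3) / (2 * real k + 2) ^ 2 \<le> 1"
      by (subst divide_le_eq_1_pos) (auto simp: power2_eq_square algebra_simps add_pos_nonneg)
  qed auto
  finally show ?case by simp
qed

lemma central_prob_even_mono:
  assumes "j \<le> k"
  shows "central_prob (2 * j) ^ 2 * real j \<le> central_prob (2 * k) ^ 2 * real k"
  using assms
proof (induction rule: dec_induct)
  case (step k)
  have "central_prob (2 * k) ^ 2 * real k
      \<le> central_prob (2 * k) ^ 2 * ((2 * real k + 1)\<^sup>2 * (real k + 1) / (2 * real k + 2) ^ 2)"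
  proof (intro mult_left_mono)
    show "real k \<le> (2 * real k + 1)\<^sup>2 * (real k + 1) / (2 * real k + 2) ^ 2"
      by (subst pos_le_divide_eq) (auto simp: power2_eq_square algebra_simps add_pos_nonneg)
  qed auto
  also have "\<dots> = central_prob (2 * Suc k) ^ 2 * real (Suc k)"
    unfolding central_prob_even_Suc by (simp add: power2_eq_square power_divide power_mult_distrib algebra_simps)
  finally show ?case using step by linarith
qed simp

lemma central_prob_upper: "central_prob n ^ 2 * (real n + 1) \<le> 1"
proof -
  obtain k where k: "n \<le> 2 * k" "central_prob n = central_prob (2 * k)"
    using central_prob_round by blast
  have "central_prob n ^ 2 * (real n + 1) \<le> central_prob (2 * k) ^ 2 * (2 * real k + 1)"
    unfolding k(2) using k(1) by (intro mult_left_mono) auto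
  then show ?thesis using central_prob_even_le[of k] by linarith
qed

lemma central_prob_compare:
  assumes "m \<le> n"
  shows "central_prob m ^ 2 * real m \<le> central_prob n ^ 2 * (real n + 1)"
proof -
  obtain j where j: "m \<le> 2 * j" "2 * j \<le> m + 1" "central_prob m = central_prob (2 * j)"
    using central_prob_round by blast
  obtain k where k: "n \<le> 2 * k" "2 * k \<le> n + 1" "central_prob n = central_prob (2 * k)"
    using central_prob_round by blast
  have "j \<le> k" using j k assms by linarith
  have "central_prob m ^ 2 * real m \<le> central_prob (2 * j) ^ 2 * (2 * real j)"
    unfolding j(3) using j(1) by (intro mult_left_mono) auto
  also have "\<dots> \<le> central_prob (2 * k) ^ 2 * (2 * real k)"
    using central_prob_even_mono[OF \<open>j \<le> k\<close>] by simp
  also have "\<dots> \<le> central_prob n ^ 2 * (real n + 1)"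
    unfolding k(3) using k(2) by (intro mult_left_mono) auto
  finally show ?thesis .
qed

lemma central_prob_lower:
  assumes "n \<ge> 1"
  shows "1 / 4 \<le> central_prob n ^ 2 * (real n + 1)"
  using central_prob_compare[OF assms] by (simp add: central_prob_def power2_eq_square)

text \<open>For fixed \<open>j\<close> the coefficients near the middle agree up to a factor \<open>1 - O(1 / n)\<close>, since each
  quotient of neighbouring ones is of this form.\<close>

lemma middle_binomial_lower:
  assumes "j \<le> s" "1 \<le> n"
  shows "real (n choose (n div 2)) * (1 - real j * (2 * real s + 4) / real n)
    \<le> real (n choose ((n + j + 1) div 2))"
  using assms(1)
proof (induction j)
  case 0
  then show ?case using choose_upper_half[of n] by simp
next
  case (Suc j)
  define C where "C = real (n choose (n div 2))"
  define A where "A = real (n choose ((n + j + 1) div 2))"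
  define B where "B = real (n choose ((n + Suc j + 1) div 2))"
  define x where "x = (2 * real s + 4) / real n"
  have IH: "C * (1 - real j * x) \<le> A" using Suc by (simp add: C_def A_def x_def)
  have "A \<le> C" using middle_binomial_decreasing[of 0 j n] choose_upper_half[of n] by (simp add: A_def C_def)
  have "B \<ge> 0" "A \<ge> 0" "x \<ge> 0" "C \<ge> 0" by (auto simp: A_def B_def C_def x_def)
  have "A * (1 - x) \<le> B"
  proof (cases "even (n + j)")
    case True
    then have "(n + Suc j + 1) div 2 = Suc ((n + j) div 2)" "(n + j + 1) div 2 = (n + j) div 2" by auto
    then have AB: "A = real (n choose ((n + j) div 2))" "B = real (n choose Suc ((n + j) div 2))"
      by (simp_all add: A_def B_def)
    have two: "real ((n + j) div 2) = (real n + real j) / 2"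
      using True by (simp add: real_of_nat_div)
    have "real (Suc ((n + j) div 2)) * B = (real n - real ((n + j) div 2)) * A"
    proof (cases "(n + j) div 2 \<le> n")
      case True
      have "Suc ((n + j) div 2) * (n choose Suc ((n + j) div 2)) = (n - (n + j) div 2) * (n choose ((n + j) div 2))"
        using binomial_absorption[of "(n + j) div 2" n] binomial_absorb_comp[of n "(n + j) div 2"] by simp
      then have "real (Suc ((n + j) div 2)) * B = real (n - (n + j) div 2) * A"
        unfolding AB by (simp only: of_nat_mult[symmetric])
      then show ?thesis using True by (simp add: of_nat_diff)
    next
      case False
      then show ?thesis by (simp add: AB binomial_eq_0)
    qed
    then have "(1 + (real n + real j) / 2) * B = (real n - (real n + real j) / 2) * A"
      by (simp only: of_nat_Suc two)
    then have B: "(real n + real j + 2) * B = (real n - real j) * A"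
      by (simp add: field_simps)
    have "(real n + real j + 2) * (1 - x) \<le> real n - real j"
    proof -
      have "2 * real j + 2 \<le> real n * x" using Suc.prems assms(2) by (simp add: x_def)
      moreover have "0 \<le> (real j + 2) * x" using \<open>x \<ge> 0\<close> by simp
      ultimately show ?thesis by (simp add: algebra_simps)
    qed
    then have "(real n + real j + 2) * (1 - x) * A \<le> (real n + real j + 2) * B"
      using \<open>A \<ge> 0\<close> unfolding B by (rule mult_right_mono)
    then have "(real n + real j + 2) * (A * (1 - x)) \<le> (real n + real j + 2) * B"
      by (simp only: mult_ac)
    then show ?thesis
      by (rule mult_left_le_imp_le) (simp add: add_nonneg_pos)
  next
    case False
    then have "(n + Suc j + 1) div 2 = (n + j + 1) div 2" by presburger
    then have "B = A" by (simp add: A_def B_def)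
    then show ?thesis using \<open>x \<ge> 0\<close> \<open>A \<ge> 0\<close> by (simp add: algebra_simps)
  qed
  have "C * (1 - real (Suc j) * x) = C * (1 - real j * x) - C * x" by (simp add: algebra_simps)
  also have "\<dots> \<le> A - A * x" using IH mult_right_mono[OF \<open>A \<le> C\<close> \<open>x \<ge> 0\<close>] by linarith
  also have "\<dots> \<le> B" using \<open>A * (1 - x) \<le> B\<close> by (simp add: algebra_simps)
  finally show ?case by (simp add: B_def C_def x_def)
qed

lemma middle_binomial_sum_lower:
  assumes "1 \<le> n"
  shows "real (n choose (n div 2)) * (real s - real s ^ 2 * (2 * real s + 4) / real n)
    \<le> real (middle_binomial_sum n s)"
proof -
  define C where "C = real (n choose (n div 2))"
  define x where "x = (2 * real s + 4) / real n"
  have "x \<ge> 0" "C \<ge> 0" by (auto simp: C_def x_def)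
  have "C * (real s - real s ^ 2 * x) = (\<Sum>j<s. C * (1 - real s * x))"
    by (simp add: algebra_simps power2_eq_square)
  also have "\<dots> \<le> (\<Sum>j<s. C * (1 - real j * x))"
    using \<open>x \<ge> 0\<close> \<open>C \<ge> 0\<close> by (intro sum_mono mult_left_mono) (auto intro!: mult_right_mono)
  also have "\<dots> \<le> (\<Sum>j<s. real (n choose ((n + j + 1) div 2)))"
    using middle_binomial_lower[of _ s n] assms by (intro sum_mono) (auto simp: C_def x_def)
  finally show ?thesis by (simp add: middle_binomial_sum_def C_def x_def)
qed

section \<open>Multisets of signed sums\<close>

text \<open>All \<open>2 ^ n\<close> sums \<open>\<plusminus> v 0 \<plusminus> \<dots> \<plusminus> v (n - 1)\<close>, counted with multiplicity.\<close>

primrec signed_sums :: "'a::ab_group_add list \<Rightarrow> 'a multiset" where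
  "signed_sums [] = {#0#}"
| "signed_sums (v # vs) =
     image_mset (\<lambda>x. x + v) (signed_sums vs) + image_mset (\<lambda>x. x - v) (signed_sums vs)"

text \<open>The number of sign patterns whose sum lies in \<open>S\<close>, that is, \<open>2 ^ n\<close> times the probability.\<close>

definition hits :: "'a::ab_group_add list \<Rightarrow> 'a set \<Rightarrow> nat" where
  "hits vs S = (\<Sum>x\<in>#signed_sums vs. of_bool (x \<in> S))"

lemma hits_Nil [simp]: "hits [] S = of_bool (0 \<in> S)"
  by (simp add: hits_def)

lemma hits_Cons: "hits (v # vs) S = hits vs {x. x + v \<in> S} + hits vs {x. x - v \<in> S}"
  by (simp add: hits_def multiset.map_comp comp_def)

lemma signed_sums_append:
  fixes f :: "'a::ab_group_add \<Rightarrow> nat"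
  shows "(\<Sum>z\<in>#signed_sums (us @ vs). f z) = (\<Sum>x\<in>#signed_sums us. \<Sum>y\<in>#signed_sums vs. f (x + y))"
proof (induction us arbitrary: f)
  case (Cons u us)
  show ?case
    using Cons.IH[of "\<lambda>z. f (z + u)"] Cons.IH[of "\<lambda>z. f (z - u)"]
    by (simp add: multiset.map_comp comp_def algebra_simps)
qed simp

lemma signed_sums_perm:
  assumes "mset us = mset vs"
  shows "signed_sums us = signed_sums vs"
proof -
  define step where "step = (\<lambda>v (M :: 'a multiset). image_mset (\<lambda>x. x + v) M + image_mset (\<lambda>x. x - v) M)"
  have "signed_sums ws = fold step (rev ws) {#0#}" for ws
    by (induction ws) (auto simp: step_def)
  moreover have "fold step (rev us) = fold step (rev vs)"
  proof (rule fold_multiset_equiv)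
    show "step v \<circ> step w = step w \<circ> step v" for v w
      by (auto simp: step_def fun_eq_iff multiset.map_comp comp_def algebra_simps)
  qed (use assms in simp)
  ultimately show ?thesis by simp
qed

lemma hits_perm: "mset us = mset vs \<Longrightarrow> hits us S = hits vs S"
  unfolding hits_def using signed_sums_perm[of us vs] by simp

lemma size_signed_sums: "size (signed_sums vs) = 2 ^ length vs"
  by (induction vs) auto

text \<open>Conditioning on the signs of \<open>us\<close>.\<close>

lemma hits_append_le:
  assumes "\<And>x. hits vs {y. x + y \<in> S} \<le> m"
  shows "hits (us @ vs) S \<le> 2 ^ length us * m"
proof -
  have "hits (us @ vs) S = (\<Sum>x\<in>#signed_sums us. hits vs {y. x + y \<in> S})"
    unfolding hits_def by (simp add: signed_sums_append)
  also have "\<dots> \<le> (\<Sum>x\<in>#signed_sums us. m)"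
    by (intro sum_mset_mono assms)
  finally show ?thesis by (simp add: size_signed_sums)
qed

lemma signed_sums_flip:
  assumes "\<And>v. \<sigma> v = v \<or> \<sigma> v = - v"
  shows "signed_sums (map \<sigma> vs) = signed_sums vs"
proof (induction vs)
  case (Cons v vs)
  then show ?case using assms[of v] by (auto simp: add.commute)
qed simp

lemma signed_sums_scaleR:
  fixes u :: "'a::real_vector"
  shows "signed_sums (map (\<lambda>r. r *\<^sub>R u) rs) = image_mset (\<lambda>r. r *\<^sub>R u) (signed_sums rs)"
  by (induction rs) (auto simp: multiset.map_comp comp_def algebra_simps)

lemma prob_signed_sum:
  "measure_pmf.prob (signs_pmf n) {\<xi>. signed_sum n v \<xi> \<in> S} = real (hits (map v [0..<n]) S) / 2 ^ n"
proof (induction n arbitrary: S)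
  case 0
  show ?case by (simp add: signs_pmf_def signed_sum_def indicator_def)
next
  case (Suc n)
  have step: "measure_pmf.prob (signs_pmf n) {\<xi>. signed_sum (Suc n) v (\<xi>(n := a)) \<in> S}
      = real (hits (map v [0..<n]) {x. x + a *\<^sub>R v n \<in> S}) / 2 ^ n" for a
  proof -
    have "signed_sum (Suc n) v (\<xi>(n := a)) = signed_sum n v \<xi> + a *\<^sub>R v n" for \<xi>
      by (simp add: signed_sum_def)
    then show ?thesis using Suc[of "{x. x + a *\<^sub>R v n \<in> S}"] by simp
  qed
  have "signs_pmf (Suc n) = bind_pmf rademacher_pmf (\<lambda>a. map_pmf (\<lambda>\<xi>. \<xi>(n := a)) (signs_pmf n))"
    unfolding signs_pmf_def lessThan_Suc map_pmf_def
    by (subst Pi_pmf_insert') auto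
  then have bind: "emeasure (measure_pmf (signs_pmf (Suc n))) {\<xi>. signed_sum (Suc n) v \<xi> \<in> S}
     = (\<integral>\<^sup>+a. emeasure (measure_pmf (signs_pmf n)) {\<xi>. signed_sum (Suc n) v (\<xi>(n := a)) \<in> S} \<partial>rademacher_pmf)"
    by (simp only: emeasure_bind_pmf emeasure_map_pmf vimage_Collect_eq)
  have "ennreal (measure_pmf.prob (signs_pmf (Suc n)) {\<xi>. signed_sum (Suc n) v \<xi> \<in> S})
     = (\<integral>\<^sup>+a. ennreal (real (hits (map v [0..<n]) {x. x + a *\<^sub>R v n \<in> S}) / 2 ^ n) \<partial>rademacher_pmf)"
    using bind unfolding measure_pmf.emeasure_eq_measure step .
  also have "\<dots> = ennreal (\<integral>a. real (hits (map v [0..<n]) {x. x + a *\<^sub>R v n \<in> S}) / 2 ^ n \<partial>rademacher_pmf)"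
    by (intro nn_integral_eq_integral integrable_measure_pmf_finite) (auto simp: rademacher_pmf_def)
  finally have "measure_pmf.prob (signs_pmf (Suc n)) {\<xi>. signed_sum (Suc n) v \<xi> \<in> S}
     = (\<integral>a. real (hits (map v [0..<n]) {x. x + a *\<^sub>R v n \<in> S}) / 2 ^ n \<partial>rademacher_pmf)"
    by (subst (asm) ennreal_inj) (auto intro!: integral_nonneg)
  also have "\<dots> = (\<Sum>a\<in>{-1, 1}. real (hits (map v [0..<n]) {x. x + a *\<^sub>R v n \<in> S}) / 2 ^ n) / 2"
    unfolding rademacher_pmf_def by (subst integral_pmf_of_set) auto
  also have "\<dots> = real (hits (v n # map v [0..<n]) S) / 2 ^ Suc n"
    by (simp add: hits_Cons add_divide_distrib add.commute)
  also have "hits (v n # map v [0..<n]) S = hits (map v [0..<Suc n]) S"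
    by (rule hits_perm) simp
  finally show ?case .
qed

section \<open>Decomposition into blocks\<close>

text \<open>One induction step of the symmetric chain construction. A block with elements \<open>xs @ [x]\<close> is
  replaced by its translate by \<open>- v\<close> together with \<open>x + v\<close>, and by the rest of its translate by \<open>v\<close>,
  so a block of size \<open>l\<close> gives blocks of sizes \<open>l + 1\<close> and \<open>l - 1\<close>.\<close>

lemma block_split:
  fixes P :: "'a::ab_group_add list \<Rightarrow> bool"
  assumes step: "\<And>b. P b \<Longrightarrow> b \<noteq> [] \<Longrightarrow>
      \<exists>xs x. mset (xs @ [x]) = mset b \<and> P (map (\<lambda>y. y - v) (xs @ [x]) @ [x + v]) \<and>
             (xs \<noteq> [] \<longrightarrow> P (map (\<lambda>y. y + v) xs))"
    and "\<forall>b\<in>set bs. b \<noteq> [] \<and> P b"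
  shows "\<exists>bs'. (\<forall>b\<in>set bs'. b \<noteq> [] \<and> P b) \<and>
    mset (concat bs') = image_mset (\<lambda>x. x + v) (mset (concat bs)) + image_mset (\<lambda>x. x - v) (mset (concat bs)) \<and>
    (\<forall>s. (\<Sum>b\<leftarrow>bs'. min (length b) (Suc s))
       = (\<Sum>b\<leftarrow>bs. min (length b) s) + (\<Sum>b\<leftarrow>bs. min (length b) (Suc (Suc s))))"
  using assms(2)
proof (induction bs)
  case Nil
  show ?case by (intro exI[of _ "[]"]) simp
next
  case (Cons b bs)
  then obtain bs' where bs': "\<forall>b\<in>set bs'. b \<noteq> [] \<and> P b"
    "mset (concat bs') = image_mset (\<lambda>x. x + v) (mset (concat bs)) + image_mset (\<lambda>x. x - v) (mset (concat bs))"
    "\<And>s. (\<Sum>b\<leftarrow>bs'. min (length b) (Suc s))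
       = (\<Sum>b\<leftarrow>bs. min (length b) s) + (\<Sum>b\<leftarrow>bs. min (length b) (Suc (Suc s)))"
    by auto
  obtain xs x where x: "mset b = mset (xs @ [x])" "P (map (\<lambda>y. y - v) (xs @ [x]) @ [x + v])"
     "xs \<noteq> [] \<Longrightarrow> P (map (\<lambda>y. y + v) xs)"
    using step[of b] Cons.prems by (metis list.set_intros(1))
  have len: "length b = Suc (length xs)"
    using arg_cong[OF x(1), of size] by simp
  show ?case
  proof (cases "xs = []")
    case True
    then show ?thesis using x bs' len
      by (intro exI[of _ "(map (\<lambda>y. y - v) (xs @ [x]) @ [x + v]) # bs'"]) auto
  next
    case False
    then show ?thesis using x bs' len
      by (intro exI[of _ "(map (\<lambda>y. y - v) (xs @ [x]) @ [x + v]) # map (\<lambda>y. y + v) xs # bs'"])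
         (auto simp: multiset.map_comp comp_def min_def)
  qed
qed

text \<open>The signed sums split into blocks satisfying \<open>P\<close> whose sizes are those of a symmetric chain
  decomposition of the Boolean lattice. In particular, if each block meets a set in at most \<open>s\<close>
  points, then the set is hit at most \<open>middle_binomial_sum n s\<close> times; the case \<open>s = 1\<close> counts the
  blocks.\<close>

lemma block_decomposition:
  fixes P :: "'a::ab_group_add list \<Rightarrow> bool"
  assumes base: "P [0]"
    and step: "\<And>v b. v \<in> U \<Longrightarrow> P b \<Longrightarrow> b \<noteq> [] \<Longrightarrow>
      \<exists>xs x. mset (xs @ [x]) = mset b \<and> P (map (\<lambda>y. y - v) (xs @ [x]) @ [x + v]) \<and>
             (xs \<noteq> [] \<longrightarrow> P (map (\<lambda>y. y + v) xs))"
    and "set vs \<subseteq> U"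
  shows "\<exists>bs. (\<forall>b\<in>set bs. P b) \<and> mset (concat bs) = signed_sums vs \<and>
    (\<forall>s. (\<Sum>b\<leftarrow>bs. min (length b) s) = middle_binomial_sum (length vs) s)"
proof -
  have "\<exists>bs. (\<forall>b\<in>set bs. b \<noteq> [] \<and> P b) \<and> mset (concat bs) = signed_sums vs \<and>
    (\<forall>s. (\<Sum>b\<leftarrow>bs. min (length b) s) = middle_binomial_sum (length vs) s)"
    using assms(3)
  proof (induction vs)
    case Nil
    have "min (Suc 0) s = middle_binomial_sum 0 s" for s by (cases s) auto
    then show ?case using base by (intro exI[of _ "[[0]]"]) auto
  next
    case (Cons v vs)
    then obtain bs where bs: "\<forall>b\<in>set bs. b \<noteq> [] \<and> P b" "mset (concat bs) = signed_sums vs"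
      "\<And>s. (\<Sum>b\<leftarrow>bs. min (length b) s) = middle_binomial_sum (length vs) s"
      by auto
    have "v \<in> U" using Cons.prems by simp
    from block_split[of P v, OF step[OF this] bs(1)]
    obtain bs' where bs': "\<forall>b\<in>set bs'. b \<noteq> [] \<and> P b"
      "mset (concat bs') = image_mset (\<lambda>x. x + v) (mset (concat bs)) + image_mset (\<lambda>x. x - v) (mset (concat bs))"
      "\<And>s. (\<Sum>b\<leftarrow>bs'. min (length b) (Suc s))
         = (\<Sum>b\<leftarrow>bs. min (length b) s) + (\<Sum>b\<leftarrow>bs. min (length b) (Suc (Suc s)))"
      by auto
    have "(\<Sum>b\<leftarrow>bs'. min (length b) s) = middle_binomial_sum (length (v # vs)) s" for s
      using bs'(3) bs(3) by (cases s) (auto simp: middle_binomial_sum_Suc_Suc)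
    then show ?case using bs'(1,2) bs(2) by (intro exI[of _ bs']) auto
  qed
  then show ?thesis by blast
qed

lemma sum_blocks_le:
  fixes f :: "'a \<Rightarrow> nat"
  assumes "mset (concat bs) = M" and "\<And>b. b \<in> set bs \<Longrightarrow> (\<Sum>x\<leftarrow>b. f x) \<le> g b"
  shows "(\<Sum>x\<in>#M. f x) \<le> (\<Sum>b\<leftarrow>bs. g b)"
proof -
  have "(\<Sum>x\<in>#M. f x) = (\<Sum>x\<leftarrow>concat bs. f x)"
    unfolding assms(1)[symmetric] by (metis mset_map sum_mset_sum_list)
  also have "\<dots> = (\<Sum>b\<leftarrow>bs. \<Sum>x\<leftarrow>b. f x)"
    by (induction bs) auto
  also have "\<dots> \<le> (\<Sum>b\<leftarrow>bs. g b)"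
    by (intro sum_list_mono assms(2))
  finally show ?thesis .
qed

section \<open>The lower bound: equal vectors\<close>

text \<open>The window \<open>(- s, s]\<close> contains exactly \<open>s\<close> integers of each parity. Its translates by \<open>1\<close> and \<open>-1\<close>
  have as union and intersection the windows for \<open>s + 1\<close> and \<open>s - 1\<close>, whence the recursion of
  \<open>middle_binomial_sum\<close>.\<close>

lemma hits_replicate_one:
  "hits (replicate n (1::real)) {x. - real s < x \<and> x \<le> real s} = middle_binomial_sum n s"
proof (induction n arbitrary: s)
  case 0
  show ?case by (cases s) auto
next
  case (Suc n)
  define H where "H = (\<lambda>a b. hits (replicate n (1::real)) {x. a < x \<and> x \<le> b})"
  have H: "H (- real t) (real t) = middle_binomial_sum n t" for t
    using Suc by (simp add: H_def)
  show ?case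
  proof (cases s)
    case 0
    then have "{x. - real s < x \<and> x \<le> real s} = {}" by auto
    with 0 show ?thesis by (simp add: hits_def)
  next
    case (Suc t)
    have "hits (replicate (Suc n) (1::real)) {x. - real s < x \<and> x \<le> real s}
       = H (- real s - 1) (real s - 1) + H (- real s + 1) (real s + 1)"
      unfolding H_def replicate_Suc hits_Cons by (auto intro!: arg_cong2[where f = "(+)"] arg_cong[where f = "hits _"])
    also have "\<dots> = H (- real s - 1) (real s + 1) + H (- real s + 1) (real s - 1)"
      unfolding H_def hits_def sum_mset.distrib[symmetric] using Suc
      by (intro arg_cong[where f = sum_mset] image_mset_cong) (auto simp: of_bool_def)
    also have "\<dots> = middle_binomial_sum n (Suc s) + middle_binomial_sum n t"
      using H[of "Suc s"] H[of t] Suc by (simp add: algebra_simps)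
    finally show ?thesis using Suc by (simp add: middle_binomial_sum_Suc_Suc)
  qed
qed

lemma signed_sums_replicate_one_parity:
  assumes "x \<in># signed_sums (replicate n (1::real))"
  shows "\<exists>k::int. x = real n + 2 * of_int k"
  using assms
proof (induction n arbitrary: x)
  case 0
  then show ?case by (intro exI[of _ 0]) simp
next
  case (Suc n)
  then consider y where "y \<in># signed_sums (replicate n (1::real))" "x = y + 1"
    | y where "y \<in># signed_sums (replicate n (1::real))" "x = y - 1"
    by auto
  then show ?case
  proof cases
    case 1
    then obtain k where "y = real n + 2 * of_int k" using Suc.IH by blast
    with 1 show ?thesis by (intro exI[of _ k]) simp
  next
    case 2
    then obtain k where "y = real n + 2 * of_int k" using Suc.IH by blast
    with 2 show ?thesis by (intro exI[of _ "k - 1"]) simp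
  qed
qed

text \<open>The \<open>s\<close> values in the window \<open>(- s, s]\<close> span a length of \<open>2 * (s - 1)\<close>, so a ball of radius
  \<open>s - 1\<close> contains them; its centre depends on the parity of \<open>n + s\<close>.\<close>

lemma hits_replicate_lower:
  fixes u :: "'a::real_normed_vector"
  assumes "norm u = 1" "real s - 1 \<le> \<Delta>" "s \<ge> 1"
  shows "\<exists>c. middle_binomial_sum n s \<le> hits (replicate n u) (cball c \<Delta>)"
proof -
  define a where "a = (if even (n + s) then 1 else 0 :: real)"
  have ball: "r *\<^sub>R u \<in> cball (a *\<^sub>R u) \<Delta>"
    if r: "r \<in># signed_sums (replicate n (1::real))" "- real s < r" "r \<le> real s" for r
  proof -
    obtain k :: int where k: "r = real n + 2 * of_int k"
      using signed_sums_replicate_one_parity[OF r(1)] by blast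
    then have rz: "r = of_int (int n + 2 * k)" by simp
    have bounds: "- int s < int n + 2 * k" "int n + 2 * k \<le> int s"
      using r(2,3) unfolding rz by linarith+
    have "\<bar>r - a\<bar> \<le> real s - 1"
    proof (cases "even (n + s)")
      case True
      have "int n + 2 * k \<noteq> - int s + 1"
      proof
        assume "int n + 2 * k = - int s + 1"
        then have "int (n + s) = 2 * (- k) + 1" by simp
        then have "odd (int (n + s))" by presburger
        then show False using True by simp
      qed
      with bounds have "- int s + 2 \<le> int n + 2 * k" by linarith
      then have "- real s + 2 \<le> r" using rz by linarith
      with True r(3) show ?thesis by (simp add: a_def)
    next
      case False
      have "int n + 2 * k \<noteq> int s"
      proof
        assume "int n + 2 * k = int s"
        then have "int (n + s) = 2 * (int n + k)" by simp
        then have "even (int (n + s))" by presburger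
        then show False using False by simp
      qed
      with bounds have "- int s + 1 \<le> int n + 2 * k" "int n + 2 * k \<le> int s - 1" by linarith+
      then have "- real s + 1 \<le> r" "r \<le> real s - 1" using rz by linarith+
      with False show ?thesis by (simp add: a_def)
    qed
    moreover have "dist (a *\<^sub>R u) (r *\<^sub>R u) = \<bar>r - a\<bar>"
      using assms(1) by (simp add: dist_norm abs_minus_commute flip: scaleR_diff_left)
    ultimately show ?thesis using assms(2) by simp
  qed
  have "middle_binomial_sum n s
      = (\<Sum>r\<in>#signed_sums (replicate n (1::real)). of_bool (- real s < r \<and> r \<le> real s))"
    using hits_replicate_one[of n s] by (simp add: hits_def)
  also have "\<dots> \<le> (\<Sum>r\<in>#signed_sums (replicate n (1::real)). of_bool (r *\<^sub>R u \<in> cball (a *\<^sub>R u) \<Delta>))"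
    using ball by (intro sum_mset_mono) (auto simp: of_bool_def)
  also have "\<dots> = hits (map (\<lambda>r. r *\<^sub>R u) (replicate n 1)) (cball (a *\<^sub>R u) \<Delta>)"
    unfolding hits_def signed_sums_scaleR by (simp add: multiset.map_comp comp_def)
  finally show ?thesis by auto
qed

section \<open>Radius less than one: Kleitman's bound\<close>

lemma parallelogram_growth:
  fixes x v :: "'a::real_inner"
  assumes "0 \<le> inner x v"
  shows "2 * norm v \<le> norm (x + 2 *\<^sub>R v)"
proof -
  have "(2 * norm v)\<^sup>2 \<le> (norm (x + 2 *\<^sub>R v))\<^sup>2"
    using assms by (simp add: power2_norm_eq_inner power_mult_distrib inner_add_left inner_add_right inner_commute[of v x])
  then show ?thesis by (rule power2_le_imp_le) simp
qed

text \<open>Blocks of sums at pairwise distance at least \<open>2\<close>. In the induction step the element of a block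
  that is maximal in the direction of the new vector is the one that changes block.\<close>

lemma kleitman_bound:
  fixes vs :: "'a::real_inner list"
  assumes "\<And>v. v \<in> set vs \<Longrightarrow> 1 \<le> norm v" "\<Delta> < 1"
  shows "hits vs (cball c \<Delta>) \<le> middle_binomial_sum (length vs) 1"
proof -
  define P where "P = (\<lambda>b::'a list. distinct b \<and> pairwise (\<lambda>x y. 2 \<le> norm (x - y)) (set b))"
  have "\<exists>xs x. mset (xs @ [x]) = mset b \<and> P (map (\<lambda>y. y - v) (xs @ [x]) @ [x + v]) \<and>
             (xs \<noteq> [] \<longrightarrow> P (map (\<lambda>y. y + v) xs))"
    if v: "v \<in> {v. 1 \<le> norm v}" and b: "P b" "b \<noteq> []" for v b
  proof -
    obtain x where x: "x \<in> set b" "\<And>y. y \<in> set b \<Longrightarrow> inner y v \<le> inner x v"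
    proof -
      have "Max ((\<lambda>y. inner y v) ` set b) \<in> (\<lambda>y. inner y v) ` set b"
        using b(2) by (intro Max_in) auto
      then obtain x where "x \<in> set b" "inner x v = Max ((\<lambda>y. inner y v) ` set b)" by auto
      then show ?thesis using that[of x] by simp
    qed
    define xs where "xs = remove1 x b"
    have m: "mset (xs @ [x]) = mset b" using x(1) by (simp add: xs_def)
    have set: "set b = insert x (set xs)" using mset_eq_setD[OF m] by simp
    have "distinct (xs @ [x])" using b(1) mset_eq_imp_distinct_iff[OF m] by (simp add: P_def)
    moreover have far: "2 \<le> norm (x + v - (y - v))" if "y \<in> set b" for y
    proof -
      have "2 * 1 \<le> 2 * norm v" using v by simp
      also have "\<dots> \<le> norm (x - y + 2 *\<^sub>R v)"
        using x(2)[OF that] by (intro parallelogram_growth) (simp add: inner_diff_left)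
      also have "x - y + 2 *\<^sub>R v = x + v - (y - v)" by (simp add: scaleR_2)
      finally show ?thesis by simp
    qed
    moreover have "x + v \<noteq> y - v" if "y \<in> set b" for y
      using far[OF that] by auto
    moreover have "2 \<le> norm (v + v)" using far[of x] x(1) by simp
    moreover from this have "- v \<noteq> v" by (metis add.right_inverse norm_zero not_numeral_le_zero)
    ultimately have "P (map (\<lambda>y. y - v) (xs @ [x]) @ [x + v])" "P (map (\<lambda>y. y + v) xs)"
      using b(1) unfolding P_def set
      by (auto simp: distinct_map inj_on_def pairwise_insert pairwise_image norm_minus_commute
          intro: pairwise_mono)
    with m show ?thesis by blast
  qed
  from block_decomposition[of P "{v. 1 \<le> norm v}" vs, OF _ this]
  obtain bs where bs: "\<forall>b\<in>set bs. P b" "mset (concat bs) = signed_sums vs"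
    "\<And>s. (\<Sum>b\<leftarrow>bs. min (length b) s) = middle_binomial_sum (length vs) s"
    using assms(1) by (auto simp: P_def)
  have "(\<Sum>x\<leftarrow>b. of_bool (x \<in> cball c \<Delta>)) \<le> min (length b) 1" if "b \<in> set bs" for b
  proof -
    have "distinct b" using bs(1) that by (auto simp: P_def)
    have "(\<Sum>x\<leftarrow>b. of_bool (x \<in> cball c \<Delta>)) = (\<Sum>x\<in>set b. of_bool (x \<in> cball c \<Delta>) :: nat)"
      using \<open>distinct b\<close> by (rule sum_list_distinct_conv_sum_set)
    also have "\<dots> = card (set b \<inter> cball c \<Delta>)"
      by (simp add: Int_def)
    finally have eq: "(\<Sum>x\<leftarrow>b. of_bool (x \<in> cball c \<Delta>)) = card (set b \<inter> cball c \<Delta>)" .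
    have "x = y" if "x \<in> set b \<inter> cball c \<Delta>" "y \<in> set b \<inter> cball c \<Delta>" for x y
    proof (rule ccontr)
      assume "x \<noteq> y"
      then have "2 \<le> norm (x - y)"
        using bs(1) \<open>b \<in> set bs\<close> that by (auto simp: P_def pairwise_def)
      also have "\<dots> \<le> 2 * \<Delta>"
        using that dist_triangle2[of x y c] by (simp add: dist_norm norm_minus_commute)
      finally show False using assms(2) by simp
    qed
    then have "card (set b \<inter> cball c \<Delta>) \<le> 1"
      by (auto simp: card_le_Suc0_iff_eq)
    moreover have "card (set b \<inter> cball c \<Delta>) \<le> length b"
      by (meson card_length card_mono finite_set inf_le1 le_trans)
    ultimately show ?thesis unfolding eq by simp
  qed
  from sum_blocks_le[OF bs(2) this] show ?thesis
    unfolding hits_def bs(3) by simp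
qed

section \<open>Chains of signed sums and the bound of Erdos\<close>

text \<open>Consecutive elements differ by flipping the sign of one vector from \<open>U\<close> from minus to plus.\<close>

definition is_chain :: "'a::real_vector set \<Rightarrow> 'a list \<Rightarrow> bool" where
  "is_chain U b \<longleftrightarrow> successively (\<lambda>x y. \<exists>v\<in>U. y = x + 2 *\<^sub>R v) b"

lemma chain_decomposition:
  fixes vs :: "'a::real_vector list"
  assumes "set vs \<subseteq> U"
  obtains bs where "\<And>b. b \<in> set bs \<Longrightarrow> is_chain U b" "mset (concat bs) = signed_sums vs"
    "\<And>s. (\<Sum>b\<leftarrow>bs. min (length b) s) = middle_binomial_sum (length vs) s"
proof -
  have "\<exists>xs x. mset (xs @ [x]) = mset b \<and> is_chain U (map (\<lambda>y. y - v) (xs @ [x]) @ [x + v]) \<and>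
             (xs \<noteq> [] \<longrightarrow> is_chain U (map (\<lambda>y. y + v) xs))"
    if v: "v \<in> U" and b: "is_chain U b" "b \<noteq> []" for v b
  proof -
    obtain xs x where bx: "b = xs @ [x]" using b(2) by (cases b rule: rev_cases) auto
    have "successively (\<lambda>y z. \<exists>w\<in>U. z = y + 2 *\<^sub>R w) (xs @ [x])"
      using b(1) unfolding bx is_chain_def .
    moreover have "x + v = x - v + 2 *\<^sub>R v" by (simp add: scaleR_2)
    ultimately have "is_chain U (map (\<lambda>y. y - v) (xs @ [x]) @ [x + v])" "is_chain U (map (\<lambda>y. y + v) xs)"
      using v unfolding is_chain_def
      by (auto simp: successively_append_iff successively_map last_map algebra_simps split: if_splits)
    then show ?thesis using bx by blast
  qed
  from block_decomposition[of "is_chain U" U vs, OF _ this assms] that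
  show ?thesis by (auto simp: is_chain_def)
qed

lemma chain_diff:
  assumes "is_chain U b" "i \<le> j" "j < length b"
  shows "\<exists>ws. set ws \<subseteq> U \<and> length ws = j - i \<and> b ! j = b ! i + 2 *\<^sub>R sum_list ws"
  using assms(2,3)
proof (induction j rule: dec_induct)
  case base
  then show ?case by (intro exI[of _ "[]"]) simp
next
  case (step j)
  then obtain ws where ws: "set ws \<subseteq> U" "length ws = j - i" "b ! j = b ! i + 2 *\<^sub>R sum_list ws"
    by auto
  obtain v where "v \<in> U" "b ! Suc j = b ! j + 2 *\<^sub>R v"
    using assms(1) step.prems unfolding is_chain_def successively_conv_nth by auto
  with ws step.hyps show ?case
    by (intro exI[of _ "v # ws"]) (auto simp: algebra_simps)
qed

lemma sum_list_of_bool: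
  "(\<Sum>x\<leftarrow>b. of_bool (Q x)) = card {i. i < length b \<and> Q (b ! i)}"
proof -
  have "(\<Sum>x\<leftarrow>b. of_bool (Q x)) = (\<Sum>i\<in>{0..<length b}. of_bool (Q (b ! i)) :: nat)"
    by (simp add: sum_list_sum_nth)
  also have "\<dots> = card ({0..<length b} \<inter> {i. Q (b ! i)})" by simp
  also have "{0..<length b} \<inter> {i. Q (b ! i)} = {i. i < length b \<and> Q (b ! i)}" by auto
  finally show ?thesis .
qed

text \<open>Used for the positions in a chain at which a ball is hit.\<close>

lemma card_le_window:
  fixes I :: "nat set"
  assumes "finite I" "\<And>i j. i \<in> I \<Longrightarrow> j \<in> I \<Longrightarrow> i < j \<Longrightarrow> j - i < s" "1 \<le> s"
  shows "card I \<le> s"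
proof (cases "I = {}")
  case False
  have "I \<subseteq> {Min I..<Min I + s}"
  proof
    fix j assume j: "j \<in> I"
    have "Min I \<in> I" "Min I \<le> j" using assms(1) False j by auto
    then show "j \<in> {Min I..<Min I + s}"
      using assms(2)[of "Min I" j] assms(3) j by (cases "Min I = j") auto
  qed
  then show ?thesis using card_mono[of "{Min I..<Min I + s}" I] by simp
qed simp

text \<open>If all the vectors advance by more than \<open>\<Delta> / s\<close> along \<open>u\<close>, then \<open>s + 1\<close> points of a chain are spread
  over more than the diameter \<open>2 * \<Delta>\<close> of the ball.\<close>

lemma erdos_bound:
  fixes vs :: "'a::real_inner list"
  assumes "norm u = 1" "1 \<le> s" "0 \<le> \<Delta>" "\<And>v. v \<in> set vs \<Longrightarrow> \<Delta> / real s < inner v u"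
  shows "hits vs (cball c \<Delta>) \<le> middle_binomial_sum (length vs) s"
proof -
  define r where "r = \<Delta> / real s"
  obtain bs where bs: "\<And>b. b \<in> set bs \<Longrightarrow> is_chain {v. r < inner v u} b"
    "mset (concat bs) = signed_sums vs"
    "\<And>s. (\<Sum>b\<leftarrow>bs. min (length b) s) = middle_binomial_sum (length vs) s"
    using chain_decomposition[of vs "{v. r < inner v u}"] assms(4) by (auto simp: r_def)
  have "(\<Sum>x\<leftarrow>b. of_bool (x \<in> cball c \<Delta>)) \<le> min (length b) s" if b: "b \<in> set bs" for b
  proof -
    let ?I = "{i. i < length b \<and> b ! i \<in> cball c \<Delta>}"
    have "j - i < s" if ij: "i \<in> ?I" "j \<in> ?I" "i < j" for i j
    proof (rule ccontr)
      assume "\<not> j - i < s"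
      obtain ws where ws: "set ws \<subseteq> {v. r < inner v u}" "length ws = j - i"
        "b ! j = b ! i + 2 *\<^sub>R sum_list ws"
        using chain_diff[OF bs(1)[OF b], of i j] ij by auto
      have gt: "ws \<noteq> [] \<longrightarrow> real (length ws) * r < inner (sum_list ws) u"
        using ws(1) by (induction ws) (auto simp: inner_add_left algebra_simps intro: add_strict_mono)
      have "\<Delta> = real s * r" using assms(2) by (simp add: r_def)
      also have "\<dots> \<le> real (length ws) * r"
        using \<open>\<not> j - i < s\<close> assms(2,3) by (intro mult_right_mono) (auto simp: ws(2) r_def)
      also have "\<dots> < inner (sum_list ws) u" using gt ij(3) ws(2) by auto
      also have "\<dots> \<le> norm (sum_list ws)"
        using norm_cauchy_schwarz[of "sum_list ws" u] assms(1) by simp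
      finally have "2 * \<Delta> < norm (b ! j - b ! i)" using ws(3) by simp
      also have "\<dots> \<le> 2 * \<Delta>"
        using ij dist_triangle2[of "b ! j" "b ! i" c] by (simp add: dist_norm norm_minus_commute)
      finally show False by simp
    qed
    then have "card ?I \<le> s" using assms(2) by (intro card_le_window) auto
    moreover have "card ?I \<le> card {..<length b}" by (intro card_mono) auto
    ultimately show ?thesis unfolding sum_list_of_bool by simp
  qed
  from sum_blocks_le[OF bs(2) this] show ?thesis
    unfolding hits_def bs(3) by simp
qed

section \<open>Vectors close to a direction\<close>

text \<open>Vectors of length at least \<open>1\<close> in the narrow one-sided cone around the unit vector \<open>u\<close>.\<close>

definition near_dir :: "'a::real_inner \<Rightarrow> real \<Rightarrow> 'a set" where
  "near_dir u \<epsilon> = {v. 1 \<le> norm v \<and> norm (v - norm v *\<^sub>R u) \<le> \<epsilon> * norm v}"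

text \<open>The number \<open>D\<close> is the sum of the lengths. Measuring the error against \<open>D\<close> instead of the norm of
  the sum makes the estimate additive.\<close>

lemma near_dir_sum_list:
  assumes "set ws \<subseteq> near_dir u \<epsilon>"
  shows "\<exists>D\<ge>real (length ws). norm (sum_list ws - D *\<^sub>R u) \<le> \<epsilon> * D"
  using assms
proof (induction ws)
  case Nil
  show ?case by (intro exI[of _ 0]) simp
next
  case (Cons w ws)
  then obtain D where D: "real (length ws) \<le> D" "norm (sum_list ws - D *\<^sub>R u) \<le> \<epsilon> * D" by auto
  have w: "1 \<le> norm w" "norm (w - norm w *\<^sub>R u) \<le> \<epsilon> * norm w"
    using Cons.prems by (auto simp: near_dir_def)
  have "sum_list (w # ws) - (norm w + D) *\<^sub>R u = (w - norm w *\<^sub>R u) + (sum_list ws - D *\<^sub>R u)"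
    by (simp add: algebra_simps)
  then have "norm (sum_list (w # ws) - (norm w + D) *\<^sub>R u) \<le> \<epsilon> * norm w + \<epsilon> * D"
    using norm_triangle_mono[OF w(2) D(2)] by (simp only:)
  then show ?case using w(1) D(1)
    by (intro exI[of _ "norm w + D"]) (simp add: algebra_simps)
qed

lemma near_dir_chain_diff:
  assumes "is_chain (near_dir u \<epsilon>) b" "i \<le> j" "j < length b"
  shows "\<exists>W D. b ! j = b ! i + 2 *\<^sub>R W \<and> real (j - i) \<le> D \<and> norm (W - D *\<^sub>R u) \<le> \<epsilon> * D"
proof -
  obtain ws where ws: "set ws \<subseteq> near_dir u \<epsilon>" "length ws = j - i" "b ! j = b ! i + 2 *\<^sub>R sum_list ws"
    using chain_diff[OF assms] by blast
  then show ?thesis using near_dir_sum_list[OF ws(1)] by metis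
qed

text \<open>A version symmetric in \<open>i\<close> and \<open>j\<close>, with a signed \<open>D\<close>.\<close>

lemma near_dir_chain_diff_signed:
  assumes "is_chain (near_dir u \<epsilon>) b" "i < length b" "j < length b"
  shows "\<exists>W D. b ! j - b ! i = 2 *\<^sub>R W \<and> \<bar>real j - real i\<bar> \<le> \<bar>D\<bar> \<and> norm (W - D *\<^sub>R u) \<le> \<epsilon> * \<bar>D\<bar>"
proof (cases "i \<le> j")
  case True
  then obtain W D where "b ! j = b ! i + 2 *\<^sub>R W" "real (j - i) \<le> D" "norm (W - D *\<^sub>R u) \<le> \<epsilon> * D"
    using near_dir_chain_diff[OF assms(1)] assms by blast
  with True show ?thesis by (intro exI[of _ W] exI[of _ D]) (auto simp: of_nat_diff)
next
  case False
  then obtain W D where W: "b ! i = b ! j + 2 *\<^sub>R W" "real (i - j) \<le> D" "norm (W - D *\<^sub>R u) \<le> \<epsilon> * D"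
    using near_dir_chain_diff[OF assms(1), of j i] assms by auto
  have "norm (- W - (- D) *\<^sub>R u) = norm (W - D *\<^sub>R u)"
    by (metis minus_diff_commute norm_minus_cancel scaleR_minus_left uminus_add_conv_diff diff_minus_eq_add minus_diff_eq)
  with False W show ?thesis by (intro exI[of _ "- W"] exI[of _ "- D"]) (auto simp: of_nat_diff)
qed

section \<open>Two separated directions\<close>

text \<open>Unit vectors at distance at least \<open>\<kappa>\<close> from each other and from each other's negatives span a
  uniformly non-degenerate plane.\<close>

lemma norm_combination_lower:
  fixes u v :: "'a::real_inner"
  assumes "norm u = 1" "norm v = 1" "0 \<le> \<kappa>" "\<kappa> \<le> norm (u - v)" "\<kappa> \<le> norm (u + v)"
  shows "\<kappa> / 2 * (\<bar>a\<bar> + \<bar>b\<bar>) \<le> norm (a *\<^sub>R u + b *\<^sub>R v)"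
proof -
  have uv: "inner u u = 1" "inner v v = 1" using assms(1,2) by (simp_all add: dot_square_norm)
  have "\<kappa>\<^sup>2 \<le> (norm (u - v))\<^sup>2" "\<kappa>\<^sup>2 \<le> (norm (u + v))\<^sup>2"
    using assms by (auto intro: power_mono)
  then have k: "\<kappa>\<^sup>2 \<le> 2 - 2 * inner u v" "\<kappa>\<^sup>2 \<le> 2 + 2 * inner u v"
    by (simp_all add: power2_norm_eq_inner inner_add_left inner_add_right inner_diff_left inner_diff_right uv inner_commute[of v u])
  have "\<bar>inner u v\<bar> \<le> 1 - \<kappa>\<^sup>2 / 2" using k by linarith
  then have "\<bar>a * b\<bar> * \<bar>inner u v\<bar> \<le> \<bar>a * b\<bar> * (1 - \<kappa>\<^sup>2 / 2)" by (intro mult_left_mono) auto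
  moreover have "- (a * b * inner u v) \<le> \<bar>a * b\<bar> * \<bar>inner u v\<bar>"
    unfolding abs_mult[symmetric] by (rule abs_ge_minus_self)
  ultimately have *: "- (a * b * inner u v) \<le> \<bar>a\<bar> * \<bar>b\<bar> * (1 - \<kappa>\<^sup>2 / 2)"
    by (simp add: abs_mult)
  have "0 \<le> (1 - \<kappa>\<^sup>2 / 4) * (\<bar>a\<bar> - \<bar>b\<bar>)\<^sup>2" using k by (intro mult_nonneg_nonneg) auto
  also have "\<dots> = \<bar>a\<bar>\<^sup>2 + \<bar>b\<bar>\<^sup>2 - 2 * (\<bar>a\<bar> * \<bar>b\<bar> * (1 - \<kappa>\<^sup>2 / 2)) - (\<kappa> / 2 * (\<bar>a\<bar> + \<bar>b\<bar>))\<^sup>2"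
    by (simp add: power2_eq_square field_simps)
  also have "\<dots> \<le> a\<^sup>2 + b\<^sup>2 + 2 * (a * b * inner u v) - (\<kappa> / 2 * (\<bar>a\<bar> + \<bar>b\<bar>))\<^sup>2"
    using * by simp
  also have "a\<^sup>2 + b\<^sup>2 + 2 * (a * b * inner u v) = (norm (a *\<^sub>R u + b *\<^sub>R v))\<^sup>2"
    unfolding power2_norm_eq_inner
    by (simp add: inner_add_left inner_add_right uv inner_commute[of v u] power2_eq_square algebra_simps)
  finally have "(\<kappa> / 2 * (\<bar>a\<bar> + \<bar>b\<bar>))\<^sup>2 \<le> (norm (a *\<^sub>R u + b *\<^sub>R v))\<^sup>2" by simp
  then show ?thesis by (rule power2_le_imp_le) simp
qed

text \<open>Sums of an element of a chain along \<open>u1\<close> and one of a chain along \<open>u2\<close> form a distorted planar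
  grid, of which a ball contains only boundedly many points.\<close>

lemma grid_hits:
  fixes u1 u2 :: "'a::real_inner"
  assumes u: "norm u1 = 1" "norm u2 = 1" "0 < \<kappa>" "\<kappa> \<le> norm (u1 - u2)" "\<kappa> \<le> norm (u1 + u2)"
    and b1: "is_chain (near_dir u1 (\<kappa> / 4)) b1" and b2: "is_chain (near_dir u2 (\<kappa> / 4)) b2"
    and K: "4 * \<Delta> / \<kappa> \<le> real K"
  shows "(\<Sum>x\<leftarrow>b1. \<Sum>y\<leftarrow>b2. of_bool (x + y \<in> cball c \<Delta>)) \<le> (2 * K + 1)\<^sup>2"
proof -
  define H where "H = (\<lambda>i j. i < length b1 \<and> j < length b2 \<and> b1 ! i + b2 ! j \<in> cball c \<Delta>)"
  have close: "\<bar>real i' - real i\<bar> + \<bar>real j' - real j\<bar> \<le> real K" if h: "H i j" "H i' j'" for i j i' j'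
  proof -
    obtain W1 D1 where 1: "b1 ! i' - b1 ! i = 2 *\<^sub>R W1" "\<bar>real i' - real i\<bar> \<le> \<bar>D1\<bar>" "norm (W1 - D1 *\<^sub>R u1) \<le> \<kappa> / 4 * \<bar>D1\<bar>"
      using near_dir_chain_diff_signed[OF b1] h unfolding H_def by blast
    obtain W2 D2 where 2: "b2 ! j' - b2 ! j = 2 *\<^sub>R W2" "\<bar>real j' - real j\<bar> \<le> \<bar>D2\<bar>" "norm (W2 - D2 *\<^sub>R u2) \<le> \<kappa> / 4 * \<bar>D2\<bar>"
      using near_dir_chain_diff_signed[OF b2] h unfolding H_def by blast
    have "norm ((b1 ! i' + b2 ! j') - (b1 ! i + b2 ! j)) \<le> 2 * \<Delta>"
      using h dist_triangle2[of "b1 ! i' + b2 ! j'" "b1 ! i + b2 ! j" c]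
      unfolding H_def by (simp add: dist_norm norm_minus_commute)
    also have "(b1 ! i' + b2 ! j') - (b1 ! i + b2 ! j) = 2 *\<^sub>R (W1 + W2)"
      using 1(1) 2(1) by (simp add: algebra_simps)
    finally have W: "norm (W1 + W2) \<le> \<Delta>" by simp
    have "D1 *\<^sub>R u1 + D2 *\<^sub>R u2 = W1 + W2 - ((W1 - D1 *\<^sub>R u1) + (W2 - D2 *\<^sub>R u2))"
      by (simp add: algebra_simps)
    then have "norm (D1 *\<^sub>R u1 + D2 *\<^sub>R u2) \<le> norm (W1 + W2) + norm ((W1 - D1 *\<^sub>R u1) + (W2 - D2 *\<^sub>R u2))"
      using norm_triangle_ineq4 by metis
    also have "\<dots> \<le> \<Delta> + (\<kappa> / 4 * \<bar>D1\<bar> + \<kappa> / 4 * \<bar>D2\<bar>)"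
      by (intro add_mono W norm_triangle_mono 1 2)
    finally have "\<kappa> / 2 * (\<bar>D1\<bar> + \<bar>D2\<bar>) \<le> \<Delta> + (\<kappa> / 4 * \<bar>D1\<bar> + \<kappa> / 4 * \<bar>D2\<bar>)"
      using norm_combination_lower[OF u(1,2) _ u(4,5), of D1 D2] u(3) by linarith
    then have "(\<bar>D1\<bar> + \<bar>D2\<bar>) * \<kappa> \<le> 4 * \<Delta>" by (simp add: algebra_simps)
    then have "\<bar>D1\<bar> + \<bar>D2\<bar> \<le> 4 * \<Delta> / \<kappa>" using u(3) by (simp add: pos_le_divide_eq)
    then show ?thesis using 1(2) 2(2) K by linarith
  qed
  have eq: "(\<Sum>x\<leftarrow>b1. \<Sum>y\<leftarrow>b2. of_bool (x + y \<in> cball c \<Delta>))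
     = (\<Sum>i\<in>{0..<length b1}. \<Sum>j\<in>{0..<length b2}. of_bool (H i j) :: nat)"
    by (simp add: sum_list_sum_nth H_def)
  show ?thesis
  proof (cases "\<exists>i j. H i j")
    case False
    then show ?thesis unfolding eq by simp
  next
    case True
    then obtain i0 j0 where H0: "H i0 j0" by blast
    have window: "(\<Sum>i\<in>{0..<n}. of_bool (\<bar>real i - real k\<bar> \<le> real K)) \<le> 2 * K + 1" for n k
    proof -
      have "(\<Sum>i\<in>{0..<n}. of_bool (\<bar>real i - real k\<bar> \<le> real K)) = card ({0..<n} \<inter> {i. \<bar>real i - real k\<bar> \<le> real K})"
        by simp
      also have "\<dots> \<le> card {k - K..k + K}"
      proof (intro card_mono subsetI)
        fix i assume "i \<in> {0..<n} \<inter> {i. \<bar>real i - real k\<bar> \<le> real K}"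
        then have "real k \<le> real i + real K" "real i \<le> real k + real K" by auto
        then show "i \<in> {k - K..k + K}" by auto
      qed simp
      also have "\<dots> \<le> 2 * K + 1" by auto
      finally show ?thesis .
    qed
    have "of_bool (H i j) \<le> (of_bool (\<bar>real i - real i0\<bar> \<le> real K) * of_bool (\<bar>real j - real j0\<bar> \<le> real K) :: nat)" for i j
      using close[OF H0, of i j] by auto
    then have "(\<Sum>i\<in>{0..<length b1}. \<Sum>j\<in>{0..<length b2}. of_bool (H i j))
      \<le> (\<Sum>i\<in>{0..<length b1}. \<Sum>j\<in>{0..<length b2}.
          of_bool (\<bar>real i - real i0\<bar> \<le> real K) * of_bool (\<bar>real j - real j0\<bar> \<le> real K) :: nat)"
      by (intro sum_mono)
    also have "\<dots> = (\<Sum>i\<in>{0..<length b1}. of_bool (\<bar>real i - real i0\<bar> \<le> real K))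
         * (\<Sum>j\<in>{0..<length b2}. of_bool (\<bar>real j - real j0\<bar> \<le> real K))"
      by (rule sum_product[symmetric])
    also have "\<dots> \<le> (2 * K + 1) * (2 * K + 1)"
      by (intro mult_mono window) auto
    finally show ?thesis unfolding eq by (simp add: power2_eq_square)
  qed
qed

lemma sum_list_sum_mset_swap:
  fixes f :: "'a \<Rightarrow> 'b \<Rightarrow> nat"
  shows "(\<Sum>x\<leftarrow>b. \<Sum>y\<in>#M. f x y) = (\<Sum>y\<in>#M. \<Sum>x\<leftarrow>b. f x y)"
  by (induction b) (auto simp: sum_mset.distrib)

text \<open>There are about \<open>2 ^ m / sqrt m\<close> chains for each of the two groups. As each pair of chains contributes
  a bounded number of hits, the probability is of the order of the reciprocal of the group size.\<close>

lemma two_directions_bound: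
  fixes u1 u2 :: "'a::real_inner"
  assumes u: "norm u1 = 1" "norm u2 = 1" "0 < \<kappa>" "\<kappa> \<le> norm (u1 - u2)" "\<kappa> \<le> norm (u1 + u2)"
    and vs: "set vs1 \<subseteq> near_dir u1 (\<kappa> / 4)" "set vs2 \<subseteq> near_dir u2 (\<kappa> / 4)"
    and K: "4 * \<Delta> / \<kappa> \<le> real K"
  shows "hits (vs1 @ vs2) (cball c \<Delta>)
    \<le> (2 * K + 1)\<^sup>2 * (middle_binomial_sum (length vs1) 1 * middle_binomial_sum (length vs2) 1)"
proof -
  define M where "M = (2 * K + 1)\<^sup>2"
  obtain bs1 where bs1: "\<And>b. b \<in> set bs1 \<Longrightarrow> is_chain (near_dir u1 (\<kappa> / 4)) b"
    "mset (concat bs1) = signed_sums vs1"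
    "\<And>s. (\<Sum>b\<leftarrow>bs1. min (length b) s) = middle_binomial_sum (length vs1) s"
    using chain_decomposition[OF vs(1)] by blast
  obtain bs2 where bs2: "\<And>b. b \<in> set bs2 \<Longrightarrow> is_chain (near_dir u2 (\<kappa> / 4)) b"
    "mset (concat bs2) = signed_sums vs2"
    "\<And>s. (\<Sum>b\<leftarrow>bs2. min (length b) s) = middle_binomial_sum (length vs2) s"
    using chain_decomposition[OF vs(2)] by blast
  have inner: "(\<Sum>x\<leftarrow>b1. \<Sum>y\<in>#signed_sums vs2. of_bool (x + y \<in> cball c \<Delta>))
      \<le> min (length b1) 1 * (M * middle_binomial_sum (length vs2) 1)" if b1: "b1 \<in> set bs1" for b1
  proof (cases "b1 = []")
    case False
    have block: "(\<Sum>y\<leftarrow>b2. \<Sum>x\<leftarrow>b1. of_bool (x + y \<in> cball c \<Delta>)) \<le> M * min (length b2) 1"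
      if "b2 \<in> set bs2" for b2
    proof (cases "b2 = []")
      case False
      have "(\<Sum>y\<leftarrow>b2. \<Sum>x\<leftarrow>b1. of_bool (y + x \<in> cball c \<Delta>)) \<le> M"
        unfolding M_def
      proof (rule grid_hits[OF u(2,1,3) _ _ bs2(1)[OF that] bs1(1)[OF b1] K])
        show "\<kappa> \<le> norm (u2 - u1)" using u(4) by (simp add: norm_minus_commute)
        show "\<kappa> \<le> norm (u2 + u1)" using u(5) by (simp add: add.commute)
      qed
      moreover have "min (length b2) 1 = 1" using False by (cases b2) auto
      ultimately show ?thesis by (simp add: add.commute)
    qed simp
    have "(\<Sum>x\<leftarrow>b1. \<Sum>y\<in>#signed_sums vs2. of_bool (x + y \<in> cball c \<Delta>))
       = (\<Sum>y\<in>#signed_sums vs2. \<Sum>x\<leftarrow>b1. of_bool (x + y \<in> cball c \<Delta>) :: nat)"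
      by (rule sum_list_sum_mset_swap)
    also have "\<dots> \<le> (\<Sum>b\<leftarrow>bs2. M * min (length b) 1)"
      using sum_blocks_le[OF bs2(2) block] .
    also have "\<dots> = M * middle_binomial_sum (length vs2) 1"
      by (simp only: sum_list_const_mult bs2(3))
    also have "\<dots> = min (length b1) 1 * (M * middle_binomial_sum (length vs2) 1)"
      using False by (cases b1) auto
    finally show ?thesis .
  qed simp
  have "hits (vs1 @ vs2) (cball c \<Delta>)
      = (\<Sum>x\<in>#signed_sums vs1. \<Sum>y\<in>#signed_sums vs2. of_bool (x + y \<in> cball c \<Delta>))"
    unfolding hits_def by (rule signed_sums_append)
  also have "\<dots> \<le> (\<Sum>b\<leftarrow>bs1. min (length b) 1 * (M * middle_binomial_sum (length vs2) 1))"
    using sum_blocks_le[OF bs1(2) inner] .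
  also have "\<dots> = middle_binomial_sum (length vs1) 1 * (M * middle_binomial_sum (length vs2) 1)"
    by (simp only: sum_list_mult_const bs1(3))
  finally show ?thesis by (simp add: M_def mult_ac)
qed

section \<open>A short projection costs one hit per chain\<close>

lemma min_max_card_le:
  fixes I :: "nat set"
  assumes "finite I" "I \<noteq> {}"
  shows "card I \<le> Max I - Min I + 1"
proof -
  have "I \<subseteq> {Min I..Max I}" using assms by auto
  then have "card I \<le> card {Min I..Max I}" by (intro card_mono) auto
  moreover have "Min I \<le> Max I" using assms by simp
  ultimately show ?thesis by simp
qed

text \<open>The points of a chain along \<open>u\<close> that fall into the two balls of radius \<open>\<Delta>\<close> centred at \<open>c - w\<close> and
  \<open>c + w\<close>. Each ball contains at most \<open>s\<close> of them; it is impossible that both contain \<open>s\<close>. If they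
  contained the same \<open>s\<close> points, the parallelogram law would put these points at distance at most
  \<open>sqrt (\<Delta>\<^sup>2 - 1) < s - 1\<close> from \<open>c\<close>, too close together. Otherwise two points at least \<open>s\<close> steps
  apart lie one in each ball, and then \<open>D *\<^sub>R u\<close>, for some \<open>D \<ge> s\<close>, is nearly within \<open>\<Delta>\<close> of \<open>w\<close> or
  \<open>- w\<close>, although the square of that distance is at least \<open>s\<^sup>2 - 2 * \<Delta> + 1\<close>.\<close>

lemma shifted_block_hits:
  fixes u w :: "'a::real_inner"
  assumes u: "norm u = 1" and w: "1 \<le> norm w" "0 \<le> inner w u" "inner w u \<le> \<Delta> / real s"
    and s: "2 \<le> s" and \<Delta>: "0 \<le> \<Delta>" "\<Delta> < real s"
    and \<epsilon>: "0 < \<epsilon>" "\<epsilon> \<le> 1 / 2"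
      "\<Delta> < (1 - \<epsilon>) * real s"
      "\<Delta>\<^sup>2 - 1 < ((1 - \<epsilon>) * (real s - 1))\<^sup>2"
      "(\<Delta> + \<epsilon> * (4 * \<Delta>))\<^sup>2 < (real s)\<^sup>2 - 2 * \<Delta> + 1"
    and b: "is_chain (near_dir u \<epsilon>) b"
  shows "(\<Sum>x\<leftarrow>b. of_bool (x + w \<in> cball c \<Delta>) + of_bool (x - w \<in> cball c \<Delta>)) \<le> 2 * s - 1"
proof -
  define I1 where "I1 = {i. i < length b \<and> b ! i + w \<in> cball c \<Delta>}"
  define I2 where "I2 = {i. i < length b \<and> b ! i - w \<in> cball c \<Delta>}"
  have fin: "finite I1" "finite I2" by (auto simp: I1_def I2_def)
  have eq: "(\<Sum>x\<leftarrow>b. of_bool (x + w \<in> cball c \<Delta>) + of_bool (x - w \<in> cball c \<Delta>)) = card I1 + card I2"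
    unfolding I1_def I2_def by (simp add: sum_list_addf sum_list_of_bool)
  have diff: "\<exists>W D. b ! j = b ! i + 2 *\<^sub>R W \<and> real (j - i) \<le> D \<and> norm (W - D *\<^sub>R u) \<le> \<epsilon> * D \<and>
      (1 - \<epsilon>) * D \<le> inner W u \<and> inner W u \<le> norm W" if ij: "i \<le> j" "j < length b" for i j
  proof -
    obtain W D where W: "b ! j = b ! i + 2 *\<^sub>R W" "real (j - i) \<le> D" "norm (W - D *\<^sub>R u) \<le> \<epsilon> * D"
      using near_dir_chain_diff[OF b ij] by blast
    have "- (\<epsilon> * D) \<le> inner (W - D *\<^sub>R u) u"
      using Cauchy_Schwarz_ineq2[of "W - D *\<^sub>R u" u] W(3) u by simp
    moreover have "inner u u = 1" using u by (simp add: dot_square_norm)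
    ultimately have "(1 - \<epsilon>) * D \<le> inner W u" by (simp add: inner_diff_left algebra_simps)
    moreover have "inner W u \<le> norm W" using norm_cauchy_schwarz[of W u] u by simp
    ultimately show ?thesis using W by blast
  qed
  have same: "j - i < s" if h: "i < j" "j < length b" "b ! i \<in> cball c' \<Delta>" "b ! j \<in> cball c' \<Delta>" for i j c'
  proof -
    obtain W D where W: "b ! j = b ! i + 2 *\<^sub>R W" "real (j - i) \<le> D" "(1 - \<epsilon>) * D \<le> norm W"
      using diff[OF less_imp_le[OF h(1)] h(2)] by (metis order_trans)
    have "norm (b ! j - b ! i) \<le> 2 * \<Delta>"
      using that dist_triangle2[of "b ! j" "b ! i" c'] by (simp add: dist_norm norm_minus_commute)
    then have "norm W \<le> \<Delta>" using W(1) by simp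
    then have "(1 - \<epsilon>) * real (j - i) < (1 - \<epsilon>) * real s"
      using W(2,3) \<epsilon>(2,3) mult_left_mono[OF W(2), of "1 - \<epsilon>"] by linarith
    then show ?thesis using \<epsilon>(2) by simp
  qed
  have I1c: "b ! i \<in> cball (c - w) \<Delta>" if "i \<in> I1" for i
    using that by (simp add: I1_def dist_norm algebra_simps)
  have I2c: "b ! i \<in> cball (c + w) \<Delta>" if "i \<in> I2" for i
    using that by (simp add: I2_def dist_norm algebra_simps)
  have len: "i < length b" if "i \<in> I1 \<union> I2" for i
    using that by (auto simp: I1_def I2_def)
  have c1: "card I1 \<le> s"
    by (rule card_le_window) (use fin s same[OF _ len I1c I1c] in auto)
  have c2: "card I2 \<le> s"
    by (rule card_le_window) (use fin s same[OF _ len I2c I2c] in auto)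
  show ?thesis
  proof (rule ccontr)
    assume "\<not> ?thesis"
    then have card: "card I1 = s" "card I2 = s" using c1 c2 unfolding eq by linarith+
    show False
    proof (cases "I1 = I2")
      case True
      define i j where "i = Min I1" and "j = Max I1"
      have ne: "I1 \<noteq> {}" using card s by auto
      have ij: "i \<in> I1" "j \<in> I1" "i \<le> j" using fin ne by (auto simp: i_def j_def)
      have "real s - 1 \<le> real (j - i)"
        using min_max_card_le[OF fin(1) ne] card s unfolding i_def j_def by linarith
      moreover obtain W D where W: "b ! j = b ! i + 2 *\<^sub>R W" "real (j - i) \<le> D" "(1 - \<epsilon>) * D \<le> norm W"
        using diff[of i j] ij unfolding I1_def mem_Collect_eq by (metis order_trans)
      ultimately have "(1 - \<epsilon>) * (real s - 1) \<le> norm W"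
        using mult_left_mono[of "real s - 1" D "1 - \<epsilon>"] \<epsilon>(2) by linarith
      have small: "norm (b ! k - c) < (1 - \<epsilon>) * (real s - 1)" if "k \<in> I1" for k
      proof -
        have "norm (b ! k - c + w) \<le> \<Delta>" "norm (b ! k - c - w) \<le> \<Delta>"
          using that \<open>I1 = I2\<close> unfolding I1_def I2_def
          by (auto simp: dist_norm norm_minus_commute algebra_simps)
        then have "(norm (b ! k - c + w))\<^sup>2 \<le> \<Delta>\<^sup>2" "(norm (b ! k - c - w))\<^sup>2 \<le> \<Delta>\<^sup>2"
          by (auto intro: power_mono)
        moreover have "(norm (b ! k - c + w))\<^sup>2 + (norm (b ! k - c - w))\<^sup>2
            = 2 * (norm (b ! k - c))\<^sup>2 + 2 * (norm w)\<^sup>2"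
          by (simp add: power2_norm_eq_inner inner_add_left inner_add_right inner_diff_left inner_diff_right)
        moreover have "1 \<le> (norm w)\<^sup>2" using w(1) by simp
        ultimately have "(norm (b ! k - c))\<^sup>2 < ((1 - \<epsilon>) * (real s - 1))\<^sup>2"
          using \<epsilon>(4) by linarith
        then show ?thesis using \<epsilon>(2) s by (intro power2_less_imp_less[of "norm _"]) auto
      qed
      have "2 * norm W = norm ((b ! j - c) - (b ! i - c))" using W(1) by simp
      also have "\<dots> \<le> norm (b ! j - c) + norm (b ! i - c)" by (rule norm_triangle_ineq4)
      also have "\<dots> < 2 * ((1 - \<epsilon>) * (real s - 1))" using small[OF ij(1)] small[OF ij(2)] by simp
      finally show False using \<open>(1 - \<epsilon>) * (real s - 1) \<le> norm W\<close> by simp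
    next
      case False
      define I where "I = I1 \<union> I2"
      define i j where "i = Min I" and "j = Max I"
      have finI: "finite I" and ne: "I \<noteq> {}" using fin card s by (auto simp: I_def)
      have ij: "i \<in> I" "j \<in> I" "i \<le> j" using finI ne by (auto simp: i_def j_def)
      then have jl: "i < length b" "j < length b" by (auto simp: I_def I1_def I2_def)
      have "I1 \<subset> I"
        using False card card_subset_eq[OF fin(1), of I2] by (auto simp: I_def)
      then have "s < card I" using psubset_card_mono[OF finI] card by auto
      then have ji: "s \<le> j - i" using min_max_card_le[OF finI ne] unfolding i_def j_def by linarith
      obtain W D where W: "b ! j = b ! i + 2 *\<^sub>R W" "real (j - i) \<le> D" "norm (W - D *\<^sub>R u) \<le> \<epsilon> * D"
          "(1 - \<epsilon>) * D \<le> inner W u"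
        using diff[of i j] ij(3) jl by blast
      have D: "real s \<le> D" using W(2) ji by linarith
      have lt: "i < j" using ji s by simp
      have "\<not> (i \<in> I1 \<and> j \<in> I1)" "\<not> (i \<in> I2 \<and> j \<in> I2)"
        using same[OF lt jl(2)] I1c I2c ji by (meson not_le)+
      then consider "i \<in> I1" "j \<in> I2" | "i \<in> I2" "j \<in> I1"
        using ij by (auto simp: I_def)
      then obtain \<sigma> :: real where \<sigma>: "\<bar>\<sigma>\<bar> = 1" "norm (W - \<sigma> *\<^sub>R w) \<le> \<Delta>"
      proof cases
        case 1
        then have "norm ((b ! j - w) - (b ! i + w)) \<le> 2 * \<Delta>"
          using dist_triangle2[of "b ! j - w" "b ! i + w" c]
          by (simp add: I1_def I2_def dist_commute dist_norm[symmetric])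
        also have "(b ! j - w) - (b ! i + w) = 2 *\<^sub>R (W - 1 *\<^sub>R w)"
          using W(1) by (simp add: algebra_simps scaleR_2)
        finally show ?thesis using that[of 1] by simp
      next
        case 2
        then have "norm ((b ! j + w) - (b ! i - w)) \<le> 2 * \<Delta>"
          using dist_triangle2[of "b ! j + w" "b ! i - w" c]
          by (simp add: I1_def I2_def dist_commute dist_norm[symmetric])
        also have "(b ! j + w) - (b ! i - w) = 2 *\<^sub>R (W - (- 1) *\<^sub>R w)"
          using W(1) by (simp add: algebra_simps scaleR_2)
        finally show ?thesis using that[of "- 1"] by simp
      qed
      define a where "a = inner w u"
      have a: "0 \<le> a" "a \<le> \<Delta> / real s" "real s * a \<le> \<Delta>" "a \<le> \<Delta>" "a \<le> 1"
      proof -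
        show a: "0 \<le> a" "a \<le> \<Delta> / real s" using w by (auto simp: a_def)
        then show sa: "real s * a \<le> \<Delta>" using s by (simp add: field_simps)
        have "1 * a \<le> real s * a" using a(1) s by (intro mult_right_mono) auto
        with sa show "a \<le> \<Delta>" by simp
        have "\<Delta> / real s \<le> 1" using \<Delta>(2) s by (simp add: field_simps)
        with a(2) show "a \<le> 1" by simp
      qed
      have \<sigma>a: "\<sigma> * a \<le> a" using \<sigma>(1) a(1) by (auto simp: abs_if split: if_splits)
      have "inner (W - \<sigma> *\<^sub>R w) u \<le> \<Delta>"
        using norm_cauchy_schwarz[of "W - \<sigma> *\<^sub>R w" u] u \<sigma>(2) by simp
      then have "inner W u \<le> \<Delta> + a" using \<sigma>a by (simp add: inner_diff_left a_def)
      moreover have "1 / 2 * D \<le> (1 - \<epsilon>) * D" using \<epsilon>(2) D by (intro mult_right_mono) auto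
      \<comment> \<open>The vector \<open>w\<close> may be long, so the length \<open>D\<close> is bounded through the projections to \<open>u\<close>.\<close>
      ultimately have "D \<le> 4 * \<Delta>" using W(4) a(4) by linarith
      have "norm (D *\<^sub>R u - \<sigma> *\<^sub>R w) \<le> norm (W - \<sigma> *\<^sub>R w) + norm (W - D *\<^sub>R u)"
        using norm_triangle_ineq4[of "W - \<sigma> *\<^sub>R w" "W - D *\<^sub>R u"] by simp
      also have "\<dots> \<le> \<Delta> + \<epsilon> * (4 * \<Delta>)"
        using \<sigma>(2) W(3) mult_left_mono[OF \<open>D \<le> 4 * \<Delta>\<close>, of \<epsilon>] \<epsilon>(1) by linarith
      finally have "(norm (D *\<^sub>R u - \<sigma> *\<^sub>R w))\<^sup>2 \<le> (\<Delta> + \<epsilon> * (4 * \<Delta>))\<^sup>2"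
        by (intro power_mono) auto
      moreover have "(norm (D *\<^sub>R u - \<sigma> *\<^sub>R w))\<^sup>2 = D\<^sup>2 - 2 * D * (\<sigma> * a) + \<sigma>\<^sup>2 * (norm w)\<^sup>2"
      proof -
        have "inner u u = 1" using u by (simp add: dot_square_norm)
        then show ?thesis
          unfolding power2_norm_eq_inner
          by (simp add: inner_diff_left inner_diff_right a_def inner_commute[of u w]
              power2_eq_square algebra_simps)
      qed
      moreover have "\<sigma>\<^sup>2 = 1" using \<sigma>(1) by (metis power2_abs one_power2)
      moreover have "1 \<le> (norm w)\<^sup>2" using w(1) by simp
      moreover have "D * (\<sigma> * a) \<le> D * a" using \<sigma>a D by (intro mult_left_mono) auto
      ultimately have "D\<^sup>2 - 2 * (D * a) + 1 \<le> (\<Delta> + \<epsilon> * (4 * \<Delta>))\<^sup>2" by (simp add: mult.assoc)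
      moreover have "0 \<le> (D - real s) * (D + real s - 2 * a)"
        using D a(5) s by (intro mult_nonneg_nonneg) auto
      then have "(real s)\<^sup>2 - 2 * (real s * a) \<le> D\<^sup>2 - 2 * (D * a)"
        by (simp add: power2_eq_square algebra_simps)
      ultimately show False using \<epsilon>(5) a(3) by linarith
    qed
  qed
qed

lemma shifted_pair_bound:
  fixes u w :: "'a::real_inner"
  assumes "norm u = 1" "1 \<le> norm w" "0 \<le> inner w u" "inner w u \<le> \<Delta> / real s"
    and "2 \<le> s" "0 \<le> \<Delta>" "\<Delta> < real s"
    and "0 < \<epsilon>" "\<epsilon> \<le> 1 / 2" "\<Delta> < (1 - \<epsilon>) * real s"
      "\<Delta>\<^sup>2 - 1 < ((1 - \<epsilon>) * (real s - 1))\<^sup>2"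
      "(\<Delta> + \<epsilon> * (4 * \<Delta>))\<^sup>2 < (real s)\<^sup>2 - 2 * \<Delta> + 1"
    and "set vs \<subseteq> near_dir u \<epsilon>"
  shows "hits (w # vs) (cball c \<Delta>) \<le> (2 * s - 1) * middle_binomial_sum (length vs) 1"
proof -
  obtain bs where bs: "\<And>b. b \<in> set bs \<Longrightarrow> is_chain (near_dir u \<epsilon>) b"
    "mset (concat bs) = signed_sums vs"
    "\<And>s. (\<Sum>b\<leftarrow>bs. min (length b) s) = middle_binomial_sum (length vs) s"
    using chain_decomposition[OF assms(13)] by blast
  have block: "(\<Sum>x\<leftarrow>b. of_bool (x + w \<in> cball c \<Delta>) + of_bool (x - w \<in> cball c \<Delta>)) \<le> (2 * s - 1) * min (length b) 1"
    if "b \<in> set bs" for b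
  proof (cases "b = []")
    case False
    then have "min (length b) 1 = 1" by (cases b) auto
    then show ?thesis using shifted_block_hits[OF assms(1-12) bs(1)[OF that]] by simp
  qed simp
  have "hits (w # vs) (cball c \<Delta>)
      = (\<Sum>x\<in>#signed_sums vs. of_bool (x + w \<in> cball c \<Delta>) + of_bool (x - w \<in> cball c \<Delta>))"
    unfolding hits_Cons unfolding hits_def by (simp add: sum_mset.distrib)
  also have "\<dots> \<le> (\<Sum>b\<leftarrow>bs. (2 * s - 1) * min (length b) 1)"
    using sum_blocks_le[OF bs(2) block] .
  finally show ?thesis by (simp only: sum_list_const_mult bs(3))
qed

section \<open>The upper bound for long sums\<close>

text \<open>The strict inequalities needed in \<open>shifted_block_hits\<close> hold in the limit \<open>\<epsilon> = 0\<close>. The last one there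
  reads \<open>\<Delta>\<^sup>2 < s\<^sup>2 - 2 * \<Delta> + 1\<close> at \<open>\<epsilon> = 0\<close>; it follows from \<open>\<Delta> < s - 1 / 2\<close>, which needs \<open>s \<ge> 2\<close>.\<close>

lemma cone_aperture_exists:
  fixes \<Delta> :: real and s :: nat
  assumes "2 \<le> s" "0 \<le> \<Delta>" "\<Delta>\<^sup>2 < (real s - 1)\<^sup>2 + 1"
  obtains \<epsilon> where "0 < \<epsilon>" "\<epsilon> \<le> 1 / 2" "\<Delta> < (1 - \<epsilon>) * real s"
    "\<Delta>\<^sup>2 - 1 < ((1 - \<epsilon>) * (real s - 1))\<^sup>2"
    "(\<Delta> + \<epsilon> * (4 * \<Delta>))\<^sup>2 < (real s)\<^sup>2 - 2 * \<Delta> + 1"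
proof -
  have "\<Delta>\<^sup>2 < (real s - 1 / 2)\<^sup>2"
    using assms(1,3) by (simp add: power2_eq_square algebra_simps)
  then have lt: "\<Delta> < real s - 1 / 2"
    using assms(1) by (intro power2_less_imp_less[of \<Delta>]) auto
  have 5: "\<Delta>\<^sup>2 < (real s)\<^sup>2 - 2 * \<Delta> + 1"
    using assms(3) lt by (simp add: power2_eq_square algebra_simps)
  have "eventually (\<lambda>\<epsilon>::real. 0 < \<epsilon>) (at_right 0)"
    by (simp add: eventually_at_right_less)
  moreover have "eventually (\<lambda>\<epsilon>::real. \<epsilon> < 1 / 2) (at_right 0)"
    by (rule order_tendstoD(2)[of "\<lambda>\<epsilon>. \<epsilon>" 0]) auto
  moreover have "eventually (\<lambda>\<epsilon>::real. \<Delta> < (1 - \<epsilon>) * real s) (at_right 0)"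
    by (rule order_tendstoD(1)[of _ "(1 - 0) * real s"]) (intro tendsto_intros, use lt in simp)
  moreover have "eventually (\<lambda>\<epsilon>::real. \<Delta>\<^sup>2 - 1 < ((1 - \<epsilon>) * (real s - 1))\<^sup>2) (at_right 0)"
    by (rule order_tendstoD(1)[of _ "((1 - 0) * (real s - 1))\<^sup>2"]) (intro tendsto_intros, use assms(3) in simp)
  moreover have "eventually (\<lambda>\<epsilon>::real. (\<Delta> + \<epsilon> * (4 * \<Delta>))\<^sup>2 < (real s)\<^sup>2 - 2 * \<Delta> + 1) (at_right 0)"
    by (rule order_tendstoD(2)[of _ "(\<Delta> + 0 * (4 * \<Delta>))\<^sup>2"]) (intro tendsto_intros, use 5 in simp)
  ultimately have "eventually (\<lambda>\<epsilon>::real. 0 < \<epsilon> \<and> \<epsilon> < 1 / 2 \<and> \<Delta> < (1 - \<epsilon>) * real s \<and>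
      \<Delta>\<^sup>2 - 1 < ((1 - \<epsilon>) * (real s - 1))\<^sup>2 \<and>
      (\<Delta> + \<epsilon> * (4 * \<Delta>))\<^sup>2 < (real s)\<^sup>2 - 2 * \<Delta> + 1) (at_right 0)"
    by eventually_elim blast
  from eventually_happens'[OF _ this] obtain \<epsilon> :: real where "0 < \<epsilon> \<and> \<epsilon> < 1 / 2 \<and> \<Delta> < (1 - \<epsilon>) * real s \<and>
      \<Delta>\<^sup>2 - 1 < ((1 - \<epsilon>) * (real s - 1))\<^sup>2 \<and>
      (\<Delta> + \<epsilon> * (4 * \<Delta>))\<^sup>2 < (real s)\<^sup>2 - 2 * \<Delta> + 1"
    by auto
  then show ?thesis using that[of \<epsilon>] by simp
qed

lemma direction_net:
  fixes \<eta> :: real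
  assumes "0 < \<eta>"
  obtains F :: "'a::euclidean_space set" where "finite F" "F \<noteq> {}" "\<And>u. u \<in> F \<Longrightarrow> norm u = 1"
    "\<And>v. 1 \<le> norm v \<Longrightarrow> \<exists>u\<in>F. v \<in> near_dir u \<eta>"
proof -
  have "seq_compact (sphere (0::'a) 1)"
    by (intro compact_imp_seq_compact compact_sphere)
  then obtain F where F: "finite F" "F \<subseteq> sphere (0::'a) 1" "sphere 0 1 \<subseteq> (\<Union>x\<in>F. ball x \<eta>)"
    using seq_compact_imp_totally_bounded[rule_format, OF _ assms] by metis
  have near: "\<exists>u\<in>F. v \<in> near_dir u \<eta>" if v: "1 \<le> norm v" for v :: 'a
  proof -
    have v0: "v \<noteq> 0" using v by auto
    then have "sgn v \<in> sphere 0 1" by (simp add: norm_sgn)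
    then obtain u where u: "u \<in> F" "norm (sgn v - u) < \<eta>"
      using F(3) by (auto simp: dist_norm norm_minus_commute)
    have "v - norm v *\<^sub>R u = norm v *\<^sub>R (sgn v - u)"
      using v0 by (simp add: sgn_div_norm algebra_simps)
    then have "norm (v - norm v *\<^sub>R u) = norm v * norm (sgn v - u)" by simp
    also have "\<dots> \<le> norm v * \<eta>" using u(2) by (intro mult_left_mono) auto
    finally have "v \<in> near_dir u \<eta>" using v by (simp add: near_dir_def mult.commute)
    then show ?thesis using u(1) by blast
  qed
  obtain b :: 'a where "b \<in> Basis" using nonempty_Basis by blast
  then have "F \<noteq> {}" using near[of b] by auto
  moreover have "norm u = 1" if "u \<in> F" for u using F(2) that by auto
  ultimately show ?thesis using that[OF F(1) _ _ near] by blast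
qed

lemma pigeonhole_filter:
  assumes "finite F" "F \<noteq> {}" "\<And>v. v \<in> set vs \<Longrightarrow> \<exists>u\<in>F. v \<in> A u"
  obtains u where "u \<in> F" "length vs \<le> card F * length (filter (\<lambda>v. v \<in> A u) vs)"
proof -
  define f where "f = (\<lambda>u. length (filter (\<lambda>v. v \<in> A u) vs))"
  have "length vs \<le> (\<Sum>u\<in>F. length (filter (\<lambda>v. v \<in> A u) vs))"
    using assms(3)
  proof (induction vs)
    case (Cons v vs)
    then obtain u0 where u0: "u0 \<in> F" "v \<in> A u0" by auto
    have "1 \<le> (\<Sum>u\<in>F. of_bool (v \<in> A u) :: nat)"
      using member_le_sum[of u0 F "\<lambda>u. of_bool (v \<in> A u) :: nat"] u0 assms(1) by simp
    moreover have "length vs \<le> (\<Sum>u\<in>F. length (filter (\<lambda>v. v \<in> A u) vs))"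
      using Cons by simp
    ultimately have "length (v # vs) \<le> (\<Sum>u\<in>F. of_bool (v \<in> A u) + length (filter (\<lambda>v. v \<in> A u) vs))"
      unfolding sum.distrib by simp
    also have "\<dots> = (\<Sum>u\<in>F. length (filter (\<lambda>v. v \<in> A u) (v # vs)))"
      by (intro sum.cong) auto
    finally show ?case .
  qed simp
  also have "\<dots> = sum f F" by (simp add: f_def)
  also have "\<dots> \<le> of_nat (card F) * Max (f ` F)"
    using assms(1) by (intro sum_bounded_above) auto
  finally have "length vs \<le> card F * Max (f ` F)" by simp
  moreover have "Max (f ` F) \<in> f ` F" using assms(1,2) by (intro Max_in) auto
  ultimately show ?thesis using that unfolding f_def by auto
qed

lemma middle_binomial_sum_central: "real (middle_binomial_sum n 1) = 2 ^ n * central_prob n"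
  by (simp add: middle_binomial_sum_1 central_prob_def)

lemma middle_binomial_sum_central_lower:
  assumes "1 \<le> s" "4 * (real s)\<^sup>2 * (2 * real s + 4) \<le> real n"
  shows "2 ^ n * ((real s - 1 / 4) * central_prob n) \<le> real (middle_binomial_sum n s)"
proof -
  have "0 < 4 * (real s)\<^sup>2 * (2 * real s + 4)" using assms(1) by simp
  then have n: "0 < real n" using assms(2) by linarith
  have "real s ^ 2 * (2 * real s + 4) / real n \<le> 1 / 4"
    using assms(2) n by (simp add: field_simps)
  then have "real (n choose (n div 2)) * (real s - 1 / 4)
      \<le> real (n choose (n div 2)) * (real s - real s ^ 2 * (2 * real s + 4) / real n)"
    by (intro mult_left_mono) auto
  also have "\<dots> \<le> real (middle_binomial_sum n s)"
    using n by (intro middle_binomial_sum_lower) simp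
  also have "real (n choose (n div 2)) * (real s - 1 / 4) = 2 ^ n * ((real s - 1 / 4) * central_prob n)"
    by (simp add: central_prob_def)
  finally show ?thesis .
qed

text \<open>A product of two central probabilities of orders proportional to \<open>n\<close> is \<open>O(1 / n)\<close>, hence
  eventually below the single central probability of order \<open>1 / sqrt n\<close>.\<close>

lemma two_clusters_negligible:
  assumes m: "real n \<le> N * real m1" "\<delta> * real n \<le> N * real m2"
    and pos: "0 < \<delta>" "0 < N" "0 \<le> M" "1 \<le> n" "8 * M\<^sup>2 * N\<^sup>2 / \<delta> \<le> real n"
  shows "M * (central_prob m1 * central_prob m2) \<le> central_prob n"
proof -
  define x where "x = real n"
  have x: "1 \<le> x" using pos(4) by (simp add: x_def)
  have "(central_prob m1)\<^sup>2 * x \<le> N"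
  proof -
    have "(central_prob m1)\<^sup>2 * x \<le> (central_prob m1)\<^sup>2 * (N * (real m1 + 1))"
      using m(1) pos(2) by (intro mult_left_mono) (auto simp: x_def algebra_simps)
    also have "\<dots> = N * ((central_prob m1)\<^sup>2 * (real m1 + 1))" by (simp only: mult_ac)
    also have "\<dots> \<le> N * 1" using pos(2) by (intro mult_left_mono central_prob_upper) auto
    finally show ?thesis by simp
  qed
  moreover have "(central_prob m2)\<^sup>2 * (\<delta> * x) \<le> N"
  proof -
    have "(central_prob m2)\<^sup>2 * (\<delta> * x) \<le> (central_prob m2)\<^sup>2 * (N * (real m2 + 1))"
      using m(2) pos(2) by (intro mult_left_mono) (auto simp: x_def algebra_simps)
    also have "\<dots> = N * ((central_prob m2)\<^sup>2 * (real m2 + 1))" by (simp only: mult_ac)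
    also have "\<dots> \<le> N * 1" using pos(2) by (intro mult_left_mono central_prob_upper) auto
    finally show ?thesis by simp
  qed
  ultimately have "((central_prob m1)\<^sup>2 * x) * ((central_prob m2)\<^sup>2 * (\<delta> * x)) \<le> N * N"
    using pos(1,2) x by (intro mult_mono) auto
  then have prod: "(central_prob m1 * central_prob m2)\<^sup>2 * (\<delta> * x\<^sup>2) \<le> N\<^sup>2"
    by (simp add: power2_eq_square mult_ac)
  have "(M * (central_prob m1 * central_prob m2))\<^sup>2 * (\<delta> * x\<^sup>2)
      = M\<^sup>2 * ((central_prob m1 * central_prob m2)\<^sup>2 * (\<delta> * x\<^sup>2))"
    by (simp add: power_mult_distrib)
  also have "\<dots> \<le> M\<^sup>2 * N\<^sup>2" using prod by (intro mult_left_mono) auto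
  also have "\<dots> \<le> \<delta> * x / 8" using pos(1,5) by (simp add: x_def field_simps)
  also have "\<dots> = \<delta> * x / 8 * 1" by simp
  also have "\<dots> \<le> \<delta> * x / 8 * (4 * ((central_prob n)\<^sup>2 * (x + 1)))"
    using central_prob_lower[OF pos(4)] pos(1) x by (intro mult_left_mono) (auto simp: x_def)
  also have "\<dots> = \<delta> * x * (x + 1) / 2 * (central_prob n)\<^sup>2" by simp
  also have "\<dots> \<le> \<delta> * x\<^sup>2 * (central_prob n)\<^sup>2"
    using x pos(1) by (intro mult_right_mono) (auto simp: power2_eq_square)
  finally have "(\<delta> * x\<^sup>2) * (M * (central_prob m1 * central_prob m2))\<^sup>2 \<le> (\<delta> * x\<^sup>2) * (central_prob n)\<^sup>2"
    by (simp only: mult_ac)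
  then have "(M * (central_prob m1 * central_prob m2))\<^sup>2 \<le> (central_prob n)\<^sup>2"
    by (rule mult_left_le_imp_le) (use x pos(1) in auto)
  then show ?thesis by (rule power2_le_imp_le) (use central_prob_pos[of n] in simp)
qed

text \<open>Discarding a proportion \<open>1 / (8 * s)\<close> of the vectors raises the central probability by less than
  what is gained by \<open>s - 1 / 2\<close> hits per chain in place of almost \<open>s\<close>.\<close>

lemma half_loss_beats_rounding:
  assumes "2 \<le> s" "p \<le> n" "(1 - 1 / (8 * real s)) * real n \<le> real p" "8 * (real s)\<^sup>2 \<le> real n"
  shows "(real s - 1 / 2) * central_prob p \<le> (real s - 1 / 4) * central_prob n"
proof -
  define x where "x = real n"
  define A B where "A = (real s - 1 / 4)\<^sup>2" and "B = (real s - 1 / 2)\<^sup>2"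
  define \<delta> where "\<delta> = 1 / (8 * real s)"
  have s: "2 \<le> real s" using assms(1) by simp
  have "0 < (real s)\<^sup>2" using s by simp
  then have x: "0 < x" using assms(4) unfolding x_def by linarith
  have "A * \<delta> \<le> (real s)\<^sup>2 * \<delta>"
    using s unfolding A_def \<delta>_def by (intro mult_right_mono power_mono) auto
  also have "\<dots> = real s / 8" using s by (simp add: \<delta>_def power2_eq_square)
  finally have "A * \<delta> \<le> real s / 8" .
  moreover have "B + 1 / 8 \<le> A - real s / 8"
    using s by (simp add: A_def B_def power2_eq_square algebra_simps)
  moreover have "A * (1 - \<delta>) = A - A * \<delta>" by (simp add: algebra_simps)
  ultimately have "B + 1 / 8 \<le> A * (1 - \<delta>)" by linarith
  then have "(B + 1 / 8) * x \<le> A * (1 - \<delta>) * x" using x by (intro mult_right_mono) auto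
  moreover have "B \<le> (real s)\<^sup>2" using s unfolding B_def by (intro power_mono) auto
  then have "B \<le> x / 8" using assms(4) by (simp add: x_def)
  ultimately have key: "B * (x + 1) \<le> A * ((1 - \<delta>) * x)" by (simp add: algebra_simps)
  have p: "(1 - \<delta>) * x \<le> real p" using assms(3) by (simp add: \<delta>_def x_def)
  have "\<delta> < 1" using s by (simp add: \<delta>_def)
  then have "0 < real p" using p x mult_pos_pos[of "1 - \<delta>" x] by linarith
  have "real p * ((real s - 1 / 2) * central_prob p)\<^sup>2 = B * ((central_prob p)\<^sup>2 * real p)"
    by (simp add: B_def power_mult_distrib)
  also have "\<dots> \<le> B * ((central_prob n)\<^sup>2 * (x + 1))"
    using central_prob_compare[OF assms(2)] unfolding x_def B_def by (intro mult_left_mono) auto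
  also have "\<dots> = B * (x + 1) * (central_prob n)\<^sup>2" by simp
  also have "\<dots> \<le> A * real p * (central_prob n)\<^sup>2"
  proof (intro mult_right_mono order_trans[OF key] mult_left_mono p)
    show "0 \<le> A" by (simp add: A_def)
  qed auto
  also have "\<dots> = real p * ((real s - 1 / 4) * central_prob n)\<^sup>2"
    by (simp add: A_def power_mult_distrib)
  finally have "((real s - 1 / 2) * central_prob p)\<^sup>2 \<le> ((real s - 1 / 4) * central_prob n)\<^sup>2"
    using \<open>0 < real p\<close> by simp
  then show ?thesis
    by (rule power2_le_imp_le) (use s central_prob_pos[of n] in simp)
qed

text \<open>The three cases: two large groups of vectors in separated directions; almost all vectors along one
  line and every projection to it longer than \<open>\<Delta> / s\<close>; almost all vectors along one line and some
  vector \<open>w\<close> with a projection of length at most \<open>\<Delta> / s\<close>.\<close>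

lemma small_ball_upper_bound:
  fixes \<Delta> :: real and s :: nat
  assumes s: "2 \<le> s" and \<Delta>: "0 \<le> \<Delta>" "\<Delta> < real s" "\<Delta>\<^sup>2 < (real s - 1)\<^sup>2 + 1"
  shows "\<exists>n0. \<forall>(vs :: 'a::euclidean_space list) c. n0 \<le> length vs \<longrightarrow> (\<forall>v\<in>set vs. 1 \<le> norm v) \<longrightarrow>
    hits vs (cball c \<Delta>) \<le> middle_binomial_sum (length vs) s"
proof -
  obtain \<epsilon> where \<epsilon>: "0 < \<epsilon>" "\<epsilon> \<le> 1 / 2" "\<Delta> < (1 - \<epsilon>) * real s"
    "\<Delta>\<^sup>2 - 1 < ((1 - \<epsilon>) * (real s - 1))\<^sup>2"
    "(\<Delta> + \<epsilon> * (4 * \<Delta>))\<^sup>2 < (real s)\<^sup>2 - 2 * \<Delta> + 1"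
    using cone_aperture_exists[OF s \<Delta>(1,3)] by blast
  \<comment> \<open>If a vector outside the \<open>\<epsilon>\<close>-cones around \<open>u\<close> and \<open>- u\<close> is in the \<open>\<kappa> / 4\<close>-cone around \<open>w\<close>, then
    \<open>w\<close> is at distance at least \<open>\<epsilon> - \<kappa> / 4 = \<kappa>\<close> from both.\<close>
  define \<kappa> where "\<kappa> = 4 * \<epsilon> / 5"
  have \<kappa>: "0 < \<kappa>" "\<kappa> + \<kappa> / 4 = \<epsilon>" using \<epsilon>(1) by (auto simp: \<kappa>_def)
  obtain F :: "'a set" where F: "finite F" "F \<noteq> {}" "\<And>u. u \<in> F \<Longrightarrow> norm u = 1"
    "\<And>v. 1 \<le> norm v \<Longrightarrow> \<exists>u\<in>F. v \<in> near_dir u (\<kappa> / 4)"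
    using direction_net[of "\<kappa> / 4"] \<kappa>(1) by auto
  define N where "N = real (card F)"
  have N: "0 < N" using F(1,2) by (simp add: N_def card_gt_0_iff)
  define K where "K = nat \<lceil>4 * \<Delta> / \<kappa>\<rceil>"
  have K: "4 * \<Delta> / \<kappa> \<le> real K" by (simp add: K_def real_nat_ceiling_ge)
  define M where "M = real ((2 * K + 1)\<^sup>2)"
  define \<delta> where "\<delta> = 1 / (8 * real s)"
  have \<delta>: "0 < \<delta>" using s by (simp add: \<delta>_def)
  define n0 where "n0 = nat \<lceil>8 * M\<^sup>2 * N\<^sup>2 / \<delta>\<rceil> + nat \<lceil>4 * (real s)\<^sup>2 * (2 * real s + 4)\<rceil> + 8 * s\<^sup>2 + 1"
  have "hits vs (cball c \<Delta>) \<le> middle_binomial_sum (length vs) s"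
    if n: "n0 \<le> length vs" and norm: "\<forall>v\<in>set vs. 1 \<le> norm v" for vs :: "'a list" and c
  proof -
    define n where "n = length vs"
    have n1: "1 \<le> n" "8 * M\<^sup>2 * N\<^sup>2 / \<delta> \<le> real n" "4 * (real s)\<^sup>2 * (2 * real s + 4) \<le> real n"
      "8 * (real s)\<^sup>2 \<le> real n"
    proof -
      have "real n0 \<le> real n" using n by (simp add: n_def)
      then have "real (nat \<lceil>8 * M\<^sup>2 * N\<^sup>2 / \<delta>\<rceil>) + real (nat \<lceil>4 * (real s)\<^sup>2 * (2 * real s + 4)\<rceil>)
          + 8 * (real s)\<^sup>2 + 1 \<le> real n"
        by (simp add: n0_def)
      moreover have "8 * M\<^sup>2 * N\<^sup>2 / \<delta> \<le> real (nat \<lceil>8 * M\<^sup>2 * N\<^sup>2 / \<delta>\<rceil>)"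
        "4 * (real s)\<^sup>2 * (2 * real s + 4) \<le> real (nat \<lceil>4 * (real s)\<^sup>2 * (2 * real s + 4)\<rceil>)"
        by (rule real_nat_ceiling_ge)+
      moreover have "0 \<le> (real s)\<^sup>2" by simp
      ultimately show "1 \<le> n" "8 * M\<^sup>2 * N\<^sup>2 / \<delta> \<le> real n" "4 * (real s)\<^sup>2 * (2 * real s + 4) \<le> real n"
        "8 * (real s)\<^sup>2 \<le> real n"
        by linarith+
    qed
    have lower: "2 ^ n * ((real s - 1 / 4) * central_prob n) \<le> real (middle_binomial_sum n s)"
      using s n1(3) by (intro middle_binomial_sum_central_lower) auto
    obtain u where u: "u \<in> F" "length vs \<le> card F * length (filter (\<lambda>v. v \<in> near_dir u (\<kappa> / 4)) vs)"
      using pigeonhole_filter[OF F(1,2), of vs "\<lambda>u. near_dir u (\<kappa> / 4)"] F(4) norm by blast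
    have u1: "norm u = 1" using F(3) u(1) by blast
    define far where "far = (\<lambda>v. v \<notin> near_dir u \<epsilon> \<and> - v \<notin> near_dir u \<epsilon>)"
    show ?thesis
    proof (cases "\<delta> * real n \<le> real (length (filter far vs))")
      case True
      obtain w where w: "w \<in> F"
        "length (filter far vs) \<le> card F * length (filter (\<lambda>v. v \<in> near_dir w (\<kappa> / 4)) (filter far vs))"
        using pigeonhole_filter[OF F(1,2), of "filter far vs" "\<lambda>u. near_dir u (\<kappa> / 4)"] F(4) norm by auto
      have w1: "norm w = 1" using F(3) w(1) by blast
      define vs1 where "vs1 = filter (\<lambda>v. v \<in> near_dir u (\<kappa> / 4)) vs"
      define vs2 where "vs2 = filter (\<lambda>v. v \<in> near_dir w (\<kappa> / 4)) (filter far vs)"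
      define vs0 where "vs0 = filter (\<lambda>v. v \<notin> near_dir u (\<kappa> / 4) \<and> \<not> (v \<in> near_dir w (\<kappa> / 4) \<and> far v)) vs"
      have disj: "\<not> (v \<in> near_dir u (\<kappa> / 4) \<and> far v)" for v
      proof -
        have "\<kappa> / 4 * norm v \<le> \<epsilon> * norm v" using \<kappa> by (intro mult_right_mono) auto
        then show ?thesis by (auto simp: far_def near_dir_def)
      qed
      have mset: "mset vs = mset (vs0 @ vs1 @ vs2)"
        unfolding vs0_def vs1_def vs2_def
        by (rule multiset_eqI) (use disj in \<open>auto simp: count_filter_mset\<close>)
      have len: "n = length vs0 + (length vs1 + length vs2)"
        using arg_cong[OF mset, of size] by (simp add: n_def)
      have m: "real n \<le> N * real (length vs1)" "\<delta> * real n \<le> N * real (length vs2)"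
      proof -
        show "real n \<le> N * real (length vs1)"
          using u(2) unfolding N_def n_def vs1_def by (simp only: of_nat_mult[symmetric] of_nat_le_iff)
        have "real (length (filter far vs)) \<le> N * real (length vs2)"
          using w(2) unfolding N_def vs2_def by (simp only: of_nat_mult[symmetric] of_nat_le_iff)
        with True show "\<delta> * real n \<le> N * real (length vs2)" by linarith
      qed
      have "0 < \<delta> * real n" using \<delta> n1(1) by simp
      then have "vs2 \<noteq> []" using m(2) by auto
      then obtain v where "v \<in> set vs2" by (cases vs2) auto
      then have v: "1 \<le> norm v" "norm (v - norm v *\<^sub>R w) \<le> \<kappa> / 4 * norm v"
         "\<epsilon> * norm v < norm (v - norm v *\<^sub>R u)" "\<epsilon> * norm v < norm (- v - norm v *\<^sub>R u)"
        by (auto simp: vs2_def far_def near_dir_def)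
      have "\<kappa> \<le> norm (u - w)" "\<kappa> \<le> norm (u + w)"
      proof -
        have "v - norm v *\<^sub>R u = (v - norm v *\<^sub>R w) - norm v *\<^sub>R (u - w)"
          "- v - norm v *\<^sub>R u = - (v - norm v *\<^sub>R w) - norm v *\<^sub>R (u + w)"
          by (simp_all add: algebra_simps)
        then have "norm (v - norm v *\<^sub>R u) \<le> norm (v - norm v *\<^sub>R w) + norm (norm v *\<^sub>R (u - w))"
          "norm (- v - norm v *\<^sub>R u) \<le> norm (v - norm v *\<^sub>R w) + norm (norm v *\<^sub>R (u + w))"
          by (metis norm_triangle_ineq4, metis norm_triangle_ineq4 norm_minus_cancel)
        then have "\<epsilon> * norm v \<le> \<kappa> / 4 * norm v + norm v * norm (u - w)"
          "\<epsilon> * norm v \<le> \<kappa> / 4 * norm v + norm v * norm (u + w)"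
          using v by simp_all
        then have "norm v * \<kappa> \<le> norm v * norm (u - w)" "norm v * \<kappa> \<le> norm v * norm (u + w)"
          unfolding \<kappa>(2)[symmetric] by (simp_all add: algebra_simps)
        then show "\<kappa> \<le> norm (u - w)" "\<kappa> \<le> norm (u + w)"
          using v(1) by (auto simp: mult_le_cancel_left)
      qed
      then have two: "hits (vs1 @ vs2) (cball c' \<Delta>)
        \<le> (2 * K + 1)\<^sup>2 * (middle_binomial_sum (length vs1) 1 * middle_binomial_sum (length vs2) 1)" for c'
        by (intro two_directions_bound[OF u1 w1 \<kappa>(1) _ _ _ _ K]) (auto simp: vs1_def vs2_def)
      have "{y. x + y \<in> cball c \<Delta>} = cball (c - x) \<Delta>" for x
        by (auto simp: dist_norm algebra_simps)
      then have "hits vs (cball c \<Delta>) \<le> 2 ^ length vs0 *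
          ((2 * K + 1)\<^sup>2 * (middle_binomial_sum (length vs1) 1 * middle_binomial_sum (length vs2) 1))"
        unfolding hits_perm[OF mset] by (intro hits_append_le) (simp only: two)
      then have "real (hits vs (cball c \<Delta>)) \<le> real (2 ^ length vs0 *
          ((2 * K + 1)\<^sup>2 * (middle_binomial_sum (length vs1) 1 * middle_binomial_sum (length vs2) 1)))"
        by (simp only: of_nat_le_iff)
      also have "\<dots> = 2 ^ n * (M * (central_prob (length vs1) * central_prob (length vs2)))"
        unfolding of_nat_mult middle_binomial_sum_central M_def len by (simp add: power_add mult_ac)
      also have "\<dots> \<le> 2 ^ n * central_prob n"
        using two_clusters_negligible[OF m \<delta> N _ n1(1,2)]
        by (intro mult_left_mono) (auto simp: M_def)
      also have "\<dots> \<le> 2 ^ n * ((real s - 1 / 4) * central_prob n)"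
      proof (intro mult_left_mono)
        have "1 * central_prob n \<le> (real s - 1 / 4) * central_prob n"
          using s central_prob_pos[of n] by (intro mult_right_mono) auto
        then show "central_prob n \<le> (real s - 1 / 4) * central_prob n" by simp
      qed simp
      also note lower
      finally show ?thesis by (simp add: n_def)
    next
      case False
      \<comment> \<open>Replacing vectors by their negatives, all of them point to the side of \<open>u\<close>.\<close>
      define \<sigma> where "\<sigma> = (\<lambda>v. if inner v u < 0 then - v else v)"
      define ws where "ws = map \<sigma> vs"
      have ws_hits: "hits vs S = hits ws S" for S
        unfolding hits_def ws_def by (subst signed_sums_flip) (auto simp: \<sigma>_def)
      have ws_len: "length ws = n" by (simp add: ws_def n_def)
      have ws: "1 \<le> norm w" "0 \<le> inner w u" if "w \<in> set ws" for w
        using that norm by (auto simp: ws_def \<sigma>_def)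
      have near_inner: "(1 - \<epsilon>) * norm v \<le> inner v u" if "v \<in> near_dir u \<epsilon>" for v
      proof -
        have "\<bar>inner (v - norm v *\<^sub>R u) u\<bar> \<le> norm (v - norm v *\<^sub>R u) * 1"
          using Cauchy_Schwarz_ineq2[of "v - norm v *\<^sub>R u" u] unfolding u1 .
        moreover have "norm (v - norm v *\<^sub>R u) \<le> \<epsilon> * norm v"
          using that by (simp add: near_dir_def)
        ultimately have "- (\<epsilon> * norm v) \<le> inner (v - norm v *\<^sub>R u) u" by linarith
        moreover have "inner u u = 1" using u1 by (simp add: dot_square_norm)
        ultimately show ?thesis by (simp add: inner_diff_left algebra_simps)
      qed
      have near_pos: "1 - \<epsilon> \<le> inner v u" if "v \<in> near_dir u \<epsilon>" for v
      proof -
        have "(1 - \<epsilon>) * 1 \<le> (1 - \<epsilon>) * norm v"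
          using that \<epsilon>(2) by (intro mult_left_mono) (auto simp: near_dir_def)
        then show ?thesis using near_inner[OF that] by simp
      qed
      have \<sigma>_near: "\<sigma> v \<in> near_dir u \<epsilon>" if "\<not> far v" for v
      proof (cases "v \<in> near_dir u \<epsilon>")
        case True
        then show ?thesis using near_pos[OF True] \<epsilon>(2) by (simp add: \<sigma>_def)
      next
        case False
        then have "- v \<in> near_dir u \<epsilon>" using that by (simp add: far_def)
        then show ?thesis using near_pos[of "- v"] \<epsilon>(2) by (simp add: \<sigma>_def)
      qed
      define near where "near = filter (\<lambda>v. v \<in> near_dir u \<epsilon>) ws"
      define p where "p = length near"
      have "length (filter (\<lambda>v. \<not> far v) vs) \<le> p"
        unfolding p_def near_def ws_def filter_map length_map
        using \<sigma>_near by (induction vs) auto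
      then have "real n - real (length (filter far vs)) \<le> real p"
        using sum_length_filter_compl[of far vs] by (simp add: n_def)
      then have p: "(1 - 1 / (8 * real s)) * real n \<le> real p"
        using False by (simp add: \<delta>_def algebra_simps)
      have pn: "p \<le> n" using length_filter_le[of _ ws] by (simp add: p_def near_def ws_len)
      show ?thesis
      proof (cases "\<forall>w\<in>set ws. \<Delta> / real s < inner w u")
        case True
        then show ?thesis
          using erdos_bound[OF u1 _ \<Delta>(1), of s ws c] s by (simp add: ws_hits ws_len n_def[symmetric])
      next
        case False
        then obtain w where w: "w \<in> set ws" "inner w u \<le> \<Delta> / real s" by auto
        have "\<Delta> / real s < 1 - \<epsilon>" using \<epsilon>(3) s by (simp add: pos_divide_less_eq)
        then have "w \<notin> near_dir u \<epsilon>" using near_pos[of w] w(2) by auto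
        then have w': "w \<in># mset (filter (\<lambda>v. v \<notin> near_dir u \<epsilon>) ws)" using w(1) by simp
        define rest where "rest = remove1 w (filter (\<lambda>v. v \<notin> near_dir u \<epsilon>) ws)"
        have mset: "mset ws = mset (rest @ (w # near))"
        proof -
          have "mset (rest @ (w # near)) = mset (filter (\<lambda>v. v \<notin> near_dir u \<epsilon>) ws) + mset near"
            using w' by (simp add: rest_def)
          also have "\<dots> = mset ws"
            unfolding near_def by (simp add: add.commute)
          finally show ?thesis ..
        qed
        have len: "n = length rest + (1 + p)"
          using arg_cong[OF mset, of size] by (simp add: p_def ws_len)
        have pair: "hits (w # near) (cball c' \<Delta>) \<le> (2 * s - 1) * middle_binomial_sum p 1" for c'
          unfolding p_def
          by (rule shifted_pair_bound[OF u1 ws[OF w(1)] w(2) s \<Delta>(1,2) \<epsilon>]) (auto simp: near_def)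
        have "{y. x + y \<in> cball c \<Delta>} = cball (c - x) \<Delta>" for x
          by (auto simp: dist_norm algebra_simps)
        then have "hits vs (cball c \<Delta>) \<le> 2 ^ length rest * ((2 * s - 1) * middle_binomial_sum p 1)"
          unfolding ws_hits hits_perm[OF mset] by (intro hits_append_le) (simp only: pair)
        then have "real (hits vs (cball c \<Delta>)) \<le> real (2 ^ length rest * ((2 * s - 1) * middle_binomial_sum p 1))"
          by (simp only: of_nat_le_iff)
        also have "\<dots> = 2 ^ n * ((real s - 1 / 2) * central_prob p)"
          unfolding of_nat_mult middle_binomial_sum_central len using s
          by (simp add: power_add of_nat_diff field_simps)
        also have "\<dots> \<le> 2 ^ n * ((real s - 1 / 4) * central_prob n)"
          using half_loss_beats_rounding[OF s pn p n1(4)] by (intro mult_left_mono) auto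
        also note lower
        finally show ?thesis by (simp add: n_def)
      qed
    qed
  qed
  then show ?thesis by blast
qed

section \<open>The exact value\<close>

theorem mainTheorem2:
  fixes \<Delta> :: real and s :: nat
  assumes "0 \<le> \<Delta>"
    and "s = nat \<lfloor>\<Delta>\<rfloor> + 1"
    and "real s - 1 \<le> \<Delta>"
    and "\<Delta> < sqrt ((real s - 1)\<^sup>2 + 1)"
  shows "\<exists>n0::nat. \<forall>n\<ge>n0.
    small_ball_prob TYPE('d::finite) n \<Delta> = real (sum_largest_binomials n s) / 2 ^ n"
proof -
  have s1: "1 \<le> s" and lt: "\<Delta> < real s"
    using assms(1,2) by (simp, linarith)
  have "\<Delta>\<^sup>2 < (sqrt ((real s - 1)\<^sup>2 + 1))\<^sup>2"
    using assms(1,4) by (intro power_strict_mono) auto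
  then have sq: "\<Delta>\<^sup>2 < (real s - 1)\<^sup>2 + 1" by simp
  have "\<exists>n0. \<forall>(vs :: (real^'d) list) c. n0 \<le> length vs \<longrightarrow> (\<forall>v\<in>set vs. 1 \<le> norm v) \<longrightarrow>
      hits vs (cball c \<Delta>) \<le> middle_binomial_sum (length vs) s"
  proof (cases "s = 1")
    case True
    then show ?thesis using kleitman_bound[of _ \<Delta>] lt by (intro exI[of _ 0]) auto
  next
    case False
    then show ?thesis using small_ball_upper_bound[of s \<Delta>] s1 assms(1) lt sq by simp
  qed
  then obtain n0 where upper: "\<And>(vs :: (real^'d) list) c. n0 \<le> length vs \<Longrightarrow> \<forall>v\<in>set vs. 1 \<le> norm v \<Longrightarrow>
      hits vs (cball c \<Delta>) \<le> middle_binomial_sum (length vs) s"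
    by blast
  have "small_ball_prob TYPE('d) n \<Delta> = real (sum_largest_binomials n s) / 2 ^ n"
    if n: "max n0 s \<le> n" for n
  proof -
    define P where "P = (\<lambda>(v :: nat \<Rightarrow> real^'d) c. measure_pmf.prob (signs_pmf n) {\<xi>. signed_sum n v \<xi> \<in> cball c \<Delta>})"
    define X where "X = {P v c | v c. \<forall>i<n. 1 \<le> norm (v i)}"
    have T: "sum_largest_binomials n s = middle_binomial_sum n s"
      using n by (intro sum_largest_binomials_eq) simp
    have P: "P v c = real (hits (map v [0..<n]) (cball c \<Delta>)) / 2 ^ n" for v c
      unfolding P_def by (rule prob_signed_sum)
    have le: "x \<le> real (middle_binomial_sum n s) / 2 ^ n" if x: "x \<in> X" for x
    proof -
      obtain v c where vc: "x = P v c" "\<forall>i<n. 1 \<le> norm (v i)" using x unfolding X_def by blast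
      have "hits (map v [0..<n]) (cball c \<Delta>) \<le> middle_binomial_sum n s"
        using upper[of "map v [0..<n]" c] n vc(2) by simp
      then show ?thesis unfolding vc(1) P by (simp add: divide_right_mono)
    qed
    obtain u :: "real^'d" where u: "norm u = 1" using vector_choose_size[of 1] by auto
    obtain c where c: "middle_binomial_sum n s \<le> hits (replicate n u) (cball c \<Delta>)"
      using hits_replicate_lower[OF u assms(3) s1] by blast
    have mem: "P (\<lambda>_. u) c \<in> X" unfolding X_def using u by (auto intro!: exI[of _ "\<lambda>_. u"])
    have "real (middle_binomial_sum n s) / 2 ^ n \<le> P (\<lambda>_. u) c"
      unfolding P using c by (simp add: map_replicate_const divide_right_mono)
    with le[OF mem] have "P (\<lambda>_. u) c = real (middle_binomial_sum n s) / 2 ^ n" by (rule antisym)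
    with mem le have "Sup X = real (middle_binomial_sum n s) / 2 ^ n"
      by (intro cSup_eq_maximum) auto
    then show ?thesis
      unfolding small_ball_prob_def T X_def P_def .
  qed
  then show ?thesis by blast
qed

end
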